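(* Let $(B,g_B)$ be a Riemannian manifold with Ricci tensor $S_B$, let $\varphi>0$ and $f$ be two smooth functions on $B$, and let $m>1$, $\lambda$, $\mu$ be real constants satisfying $$S_B+\operatorname{Hess}(f)-\frac{m}{\varphi}\operatorname{Hess}(\varphi)+\lambda g_B+\mu\,df\otimes df=0.$$ Let $(F,g_F)$ be an $m$-dimensional Riemannian manifold with Ricci tensor $S_F$. Let $B\times_{\varphi}F$ be the warped product, i.e. the product manifold $B\times F$ with the metric $g:=\pi^*g_B+(\varphi\circ\pi)^2\sigma^*g_F$, where $\pi:B\times F\to B$ and $\sigma:B\times F\to F$ are the projections; let $\widetilde f:=f\circ\pi$, $\xi:=\operatorname{grad}(\widetilde f)$ (gradient with respect to $g$), and let $\eta$ be the $g$-dual $1$-form of $\xi$. Then $(g,\xi,\lambda,\mu)$ is a gradient $\eta$-Ricci soliton on $(B\times_{\varphi}F,g)$ if and only if $$S_B=-\operatorname{Hess}(f)+\frac{m}{\varphi}\operatorname{Hess}(\varphi)-\lambda g_B-\mu\,df\otimes df$$ and $$S_F=k\,g_F,$$ where $k:=\pi^*\big[-\lambda\varphi^2+\varphi\Delta(\varphi)+(m-1)|\operatorname{grad}(\varphi)|^2-\varphi\,(\operatorname{grad}(f))(\varphi)\big]\big|_F$.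
   Context: A tuple $(g,\xi,\lambda,\mu)$ with $\xi=\operatorname{grad}(u)$ for a smooth function $u$ on a manifold $N$, and $\lambda,\mu$ real constants, is a gradient $\eta$-Ricci soliton on $N$ if $\mathcal{L}_{\xi}g+2S+2\lambda g+2\mu\,\eta\otimes\eta=0$, equivalently $\operatorname{Hess}(u)+S+\lambda g+\mu\,\eta\otimes\eta=0$, where $S$ is the Ricci tensor of $g$ and $\mathcal{L}$ the Lie derivative. For functions on $B$, $\operatorname{grad}$, $\operatorname{Hess}$, $|\cdot|$ and $\Delta=\operatorname{div}\circ\operatorname{grad}$ are taken with respect to $g_B$, and $(\operatorname{grad}(f))(\varphi)$ is the derivative of $\varphi$ along $\operatorname{grad}(f)$. In the definition of $k$, the bracket is a function on $B$, pulled back by $\pi$ to $B\times F$ and restricted to the fibers $\{p\}\times F$, $p\in B$, each identified with $F$ (on the fiber over $p$ it is the constant value of the bracket at $p$); the equation $S_F=k\,g_F$ is understood to hold on every such fiber. *)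

theory Defs
  imports "HOL-Analysis.Analysis"
begin

section \<open>Smooth maps between Euclidean spaces\<close>

primrec Ck_on :: "nat \<Rightarrow> 'e::euclidean_space set \<Rightarrow> ('e \<Rightarrow> 'v::real_normed_vector) \<Rightarrow> bool" where
  "Ck_on 0 S h \<longleftrightarrow> continuous_on S h"
| "Ck_on (Suc k) S h \<longleftrightarrow>
     (\<forall>x\<in>S. h differentiable (at x)) \<and>
     (\<forall>e. Ck_on k S (\<lambda>x. frechet_derivative h (at x) e))"

definition smooth_on :: "'e::euclidean_space set \<Rightarrow> ('e \<Rightarrow> 'v::real_normed_vector) \<Rightarrow> bool" where
  "smooth_on S h \<longleftrightarrow> (\<forall>k. Ck_on k S h)"


section \<open>Smooth manifolds\<close>

text \<open>A chart is a pair of a domain and a coordinate map.  The dimension of a manifold is the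
  dimension of the Euclidean space in which its charts take values.  The atlas need not be
  maximal.\<close>

type_synonym ('a, 'e) chart = "'a set \<times> ('a \<Rightarrow> 'e)"

record ('a, 'e) manifold =
  mtop :: "'a topology"
  atlas :: "('a, 'e) chart set"

definition chart_inv :: "('a, 'e) chart \<Rightarrow> 'e \<Rightarrow> 'a" where
  "chart_inv c = inv_into (fst c) (snd c)"

definition points :: "('a, 'e) manifold \<Rightarrow> 'a set" where
  "points M = topspace (mtop M)"

definition smooth_manifold :: "('a, 'e::euclidean_space) manifold \<Rightarrow> bool" where
  "smooth_manifold M \<longleftrightarrow>
     Hausdorff_space (mtop M) \<and> second_countable (mtop M) \<and>
     (\<Union>c\<in>atlas M. fst c) = points M \<and>
     (\<forall>c\<in>atlas M. openin (mtop M) (fst c) \<and> open (snd c ` fst c) \<and>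
        homeomorphic_map (subtopology (mtop M) (fst c)) (top_of_set (snd c ` fst c)) (snd c)) \<and>
     (\<forall>c\<in>atlas M. \<forall>d\<in>atlas M. smooth_on (snd c ` (fst c \<inter> fst d)) (snd d \<circ> chart_inv c))"

definition smooth_fun :: "('a, 'e::euclidean_space) manifold \<Rightarrow> ('a \<Rightarrow> real) \<Rightarrow> bool" where
  "smooth_fun M h \<longleftrightarrow> (\<forall>c\<in>atlas M. smooth_on (snd c ` fst c) (h \<circ> chart_inv c))"

definition prod_manifold :: "('a, 'e) manifold \<Rightarrow> ('b, 'f) manifold \<Rightarrow> ('a \<times> 'b, 'e \<times> 'f) manifold"
  where
  "prod_manifold M N =
     \<lparr>mtop = prod_topology (mtop M) (mtop N),
      atlas = {(fst c \<times> fst d, map_prod (snd c) (snd d)) | c d. c \<in> atlas M \<and> d \<in> atlas N}\<rparr>"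


section \<open>Tangent vectors\<close>

text \<open>A tangent vector at a point is a directional derivative, acting on the real functions that
  are differentiable at the point.  The value 0 on all other functions makes the functional
  independent of the chart used to express it.\<close>

type_synonym 'a tvec = "('a \<Rightarrow> real) \<Rightarrow> real"
type_synonym 'a vfield = "'a \<Rightarrow> 'a tvec"
type_synonym 'a tensor2 = "'a \<Rightarrow> 'a tvec \<Rightarrow> 'a tvec \<Rightarrow> real"

text \<open>For a basis vector \<open>i\<close>, \<open>coord_vec c p i\<close> is the coordinate vector \<open>\<partial>\<^sub>i\<close> of the chart
  \<open>c\<close> at \<open>p\<close>; so \<open>coord_vec c p i h\<close> is the \<open>i\<close>-th partial derivative of \<open>h\<close> at \<open>p\<close>.\<close>

definition coord_vec :: "('a, 'e::euclidean_space) chart \<Rightarrow> 'a \<Rightarrow> 'e \<Rightarrow> 'a tvec" where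
  "coord_vec c p e = (\<lambda>h.
     if (h \<circ> chart_inv c) differentiable (at (snd c p))
     then frechet_derivative (h \<circ> chart_inv c) (at (snd c p)) e else 0)"

definition tangent_space :: "('a, 'e::euclidean_space) manifold \<Rightarrow> 'a \<Rightarrow> 'a tvec set" where
  "tangent_space M p = {coord_vec c p e | c e. c \<in> atlas M \<and> p \<in> fst c}"

definition vec_comp :: "('a, 'e::euclidean_space) chart \<Rightarrow> 'a tvec \<Rightarrow> 'e \<Rightarrow> real" where
  "vec_comp c v i = v (\<lambda>q. snd c q \<bullet> i)"

definition pushforward :: "('a \<Rightarrow> 'b) \<Rightarrow> 'a tvec \<Rightarrow> 'b tvec" where
  "pushforward F v = (\<lambda>h. v (h \<circ> F))"


section \<open>Riemannian metrics\<close>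

definition riemannian_manifold :: "('a, 'e::euclidean_space) manifold \<Rightarrow> 'a tensor2 \<Rightarrow> bool" where
  "riemannian_manifold M g \<longleftrightarrow>
     smooth_manifold M \<and>
     (\<forall>p\<in>points M. \<forall>u\<in>tangent_space M p. \<forall>v\<in>tangent_space M p.
        g p u v = g p v u \<and>
        (\<forall>w\<in>tangent_space M p. \<forall>a b.
           g p (\<lambda>h. a * u h + b * v h) w = a * g p u w + b * g p v w) \<and>
        (u \<noteq> (\<lambda>h. 0) \<longrightarrow> g p u u > 0)) \<and>
     (\<forall>c\<in>atlas M. \<forall>i\<in>Basis. \<forall>j\<in>Basis.
        smooth_on (snd c ` fst c)
          ((\<lambda>q. g q (coord_vec c q i) (coord_vec c q j)) \<circ> chart_inv c))"

text \<open>The metric \<open>\<pi>\<^sup>* g\<^sub>B + (\<phi> \<circ> \<pi>)\<^sup>2 \<sigma>\<^sup>* g\<^sub>F\<close>, where \<open>\<pi> = fst\<close> and \<open>\<sigma> = snd\<close>.\<close>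

definition warped_metric :: "('a \<Rightarrow> real) \<Rightarrow> 'a tensor2 \<Rightarrow> 'b tensor2 \<Rightarrow> ('a \<times> 'b) tensor2" where
  "warped_metric \<phi> gB gF = (\<lambda>z v w.
     gB (fst z) (pushforward fst v) (pushforward fst w)
     + ((\<phi> \<circ> fst) z)\<^sup>2 * gF (snd z) (pushforward snd v) (pushforward snd w))"

definition grad ::
  "('a, 'e::euclidean_space) manifold \<Rightarrow> 'a tensor2 \<Rightarrow> ('a \<Rightarrow> real) \<Rightarrow> 'a vfield" where
  "grad M g u p =
     (THE v. v \<in> tangent_space M p \<and> (\<forall>w\<in>tangent_space M p. g p v w = w u))"

definition dual_form :: "'a tensor2 \<Rightarrow> 'a vfield \<Rightarrow> 'a \<Rightarrow> 'a tvec \<Rightarrow> real" where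
  "dual_form g \<xi> p v = g p (\<xi> p) v"

definition differential :: "('a \<Rightarrow> real) \<Rightarrow> 'a \<Rightarrow> 'a tvec \<Rightarrow> real" where
  "differential u p v = v u"


section \<open>Objects derived from the Levi-Civita connection\<close>

text \<open>These are defined by their expressions in a chart \<open>c\<close>.  The resulting tensors and functions
  do not depend on the chart; equations between them are stated for every chart of the atlas
  around the point in question.\<close>

definition metric_comp :: "'a tensor2 \<Rightarrow> ('a, 'e::euclidean_space) chart \<Rightarrow> 'e \<Rightarrow> 'e \<Rightarrow> 'a \<Rightarrow> real"
  where
  "metric_comp g c i j p = g p (coord_vec c p i) (coord_vec c p j)"

text \<open>\<open>metric_op\<close> is the linear map with matrix \<open>g\<^sub>i\<^sub>j\<close> in the standard basis, so
  \<open>metric_inv\<close> gives the entries \<open>g\<^sup>k\<^sup>l\<close> of the inverse matrix.\<close>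

definition metric_op :: "'a tensor2 \<Rightarrow> ('a, 'e::euclidean_space) chart \<Rightarrow> 'a \<Rightarrow> 'e \<Rightarrow> 'e" where
  "metric_op g c p e = (\<Sum>i\<in>Basis. \<Sum>j\<in>Basis. (metric_comp g c i j p * (e \<bullet> j)) *\<^sub>R i)"

definition metric_inv :: "'a tensor2 \<Rightarrow> ('a, 'e::euclidean_space) chart \<Rightarrow> 'e \<Rightarrow> 'e \<Rightarrow> 'a \<Rightarrow> real"
  where
  "metric_inv g c k l p = inv (metric_op g c p) l \<bullet> k"

text \<open>\<open>christoffel g c k i j\<close> is \<open>\<Gamma>\<^sup>k\<^sub>i\<^sub>j\<close>, i.e. the \<open>k\<close>-th component of
  \<open>\<nabla>\<close> of \<open>\<partial>\<^sub>j\<close> along \<open>\<partial>\<^sub>i\<close>.\<close>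

definition christoffel ::
  "'a tensor2 \<Rightarrow> ('a, 'e::euclidean_space) chart \<Rightarrow> 'e \<Rightarrow> 'e \<Rightarrow> 'e \<Rightarrow> 'a \<Rightarrow> real" where
  "christoffel g c k i j p =
     (\<Sum>l\<in>Basis. metric_inv g c k l p *
        (coord_vec c p i (metric_comp g c j l) + coord_vec c p j (metric_comp g c i l)
         - coord_vec c p l (metric_comp g c i j))) / 2"

text \<open>\<open>riemann_comp g c l k i j\<close> is the \<open>l\<close>-th component of \<open>R(\<partial>\<^sub>k, \<partial>\<^sub>i) \<partial>\<^sub>j\<close>, where
  \<open>R(X, Y) Z\<close> is \<open>\<nabla>\<^sub>X \<nabla>\<^sub>Y Z - \<nabla>\<^sub>Y \<nabla>\<^sub>X Z - \<nabla>\<^bsub>[X, Y]\<^esub> Z\<close>.\<close>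

definition riemann_comp ::
  "'a tensor2 \<Rightarrow> ('a, 'e::euclidean_space) chart \<Rightarrow> 'e \<Rightarrow> 'e \<Rightarrow> 'e \<Rightarrow> 'e \<Rightarrow> 'a \<Rightarrow> real" where
  "riemann_comp g c l k i j p =
     coord_vec c p k (christoffel g c l i j) - coord_vec c p i (christoffel g c l k j)
     + (\<Sum>r\<in>Basis. christoffel g c l k r p * christoffel g c r i j p
                   - christoffel g c l i r p * christoffel g c r k j p)"

text \<open>\<open>S(Y, Z)\<close> is the trace of \<open>X \<mapsto> R(X, Y) Z\<close> (positive on round spheres).\<close>

definition ricci :: "'a tensor2 \<Rightarrow> ('a, 'e::euclidean_space) chart \<Rightarrow> 'a tensor2" where
  "ricci g c p v w =
     (\<Sum>i\<in>Basis. \<Sum>j\<in>Basis. (\<Sum>k\<in>Basis. riemann_comp g c k k i j p) * vec_comp c v i * vec_comp c w j)"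

definition hess ::
  "'a tensor2 \<Rightarrow> ('a, 'e::euclidean_space) chart \<Rightarrow> ('a \<Rightarrow> real) \<Rightarrow> 'a tensor2" where
  "hess g c u p v w =
     (\<Sum>i\<in>Basis. \<Sum>j\<in>Basis.
        (coord_vec c p i (\<lambda>q. coord_vec c q j u)
         - (\<Sum>k\<in>Basis. christoffel g c k i j p * coord_vec c p k u)) * vec_comp c v i * vec_comp c w j)"

text \<open>The trace of \<open>X \<mapsto> \<nabla>\<^sub>X \<xi>\<close>.\<close>

definition divergence ::
  "'a tensor2 \<Rightarrow> ('a, 'e::euclidean_space) chart \<Rightarrow> 'a vfield \<Rightarrow> 'a \<Rightarrow> real" where
  "divergence g c \<xi> p =
     (\<Sum>i\<in>Basis. coord_vec c p i (\<lambda>q. vec_comp c (\<xi> q) i)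
        + (\<Sum>j\<in>Basis. christoffel g c i i j p * vec_comp c (\<xi> p) j))"

definition laplacian :: "('a, 'e::euclidean_space) manifold \<Rightarrow> 'a tensor2 \<Rightarrow>
    ('a, 'e) chart \<Rightarrow> ('a \<Rightarrow> real) \<Rightarrow> 'a \<Rightarrow> real" where
  "laplacian M g c u = divergence g c (grad M g u)"

text \<open>The coordinate expression of the Lie derivative of \<open>g\<close> along \<open>\<xi>\<close>.\<close>

definition lie_deriv ::
  "'a tensor2 \<Rightarrow> ('a, 'e::euclidean_space) chart \<Rightarrow> 'a vfield \<Rightarrow> 'a tensor2" where
  "lie_deriv g c \<xi> p v w =
     (\<Sum>i\<in>Basis. \<Sum>j\<in>Basis.
        (\<Sum>k\<in>Basis. vec_comp c (\<xi> p) k * coord_vec c p k (metric_comp g c i j)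
           + metric_comp g c k j p * coord_vec c p i (\<lambda>q. vec_comp c (\<xi> q) k)
           + metric_comp g c i k p * coord_vec c p j (\<lambda>q. vec_comp c (\<xi> q) k))
        * vec_comp c v i * vec_comp c w j)"


section \<open>Gradient eta-Ricci solitons\<close>

definition gradient_eta_ricci_soliton :: "('a, 'e::euclidean_space) manifold \<Rightarrow> 'a tensor2 \<Rightarrow>
    'a vfield \<Rightarrow> real \<Rightarrow> real \<Rightarrow> bool" where
  "gradient_eta_ricci_soliton M g \<xi> lam mu \<longleftrightarrow>
     (\<exists>u. smooth_fun M u \<and> (\<forall>p\<in>points M. \<xi> p = grad M g u p)) \<and>
     (\<forall>c\<in>atlas M. \<forall>p\<in>fst c. \<forall>v\<in>tangent_space M p. \<forall>w\<in>tangent_space M p.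
        lie_deriv g c \<xi> p v w + 2 * ricci g c p v w + 2 * lam * g p v w
        + 2 * mu * (dual_form g \<xi> p v * dual_form g \<xi> p w) = 0)"

end

theory Submission
  imports Defs
begin

text \<open>In a product chart the metric is block diagonal, so the Christoffel symbols and the Ricci tensor
  of the warped product can be computed explicitly: the mixed Ricci components vanish, the base block is
  \<open>S\<^sub>B - (m/\<phi>) Hess \<phi>\<close> and the fibre block is \<open>S\<^sub>F - (\<phi> \<Delta>\<phi> + (m - 1) |grad \<phi>|\<^sup>2) g\<^sub>F\<close>.
  Likewise \<open>Hess (f \<circ> \<pi>)\<close> has base block \<open>Hess f\<close> and fibre block \<open>\<phi> (grad f)(\<phi>) g\<^sub>F\<close>, and
  \<open>\<L>\<^sub>\<xi> g = 2 Hess (f \<circ> \<pi>)\<close>.  Hence the soliton tensor is twice the base equation, which holds by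
  hypothesis, plus twice \<open>S\<^sub>F - k g\<^sub>F\<close>.\<close>

section \<open>Calculus in Euclidean spaces\<close>

text \<open>Derivatives default to 0 at functions that are not differentiable, so each product rule
  in the curvature computation has to be paid for with differentiability. The Christoffel symbols of
  a product chart are of two kinds. Some vanish or are symbols of one factor, pulled back;
  differentiability transfers both ways along a projection, so \<open>coord_vec\<close> of a
  pulled-back function always agrees with \<open>coord_vec\<close> in the factor. The others are
  products: d\<phi>/\<phi> times a Kronecker delta, and - \<phi> grad \<phi> times g_F.
  Differentiating the latter involves the derivative of grad \<phi>, hence of the inverse metric,
  whose columns are treated as solutions of a linear system with differentiable coefficients. The
  second analytic input is the symmetry of second derivatives: the Lie derivative is visibly
  symmetric in its two arguments, while \<open>hess\<close> takes two derivatives in a fixed order.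
  The constant m - 1 is a trace: of the m fibre coordinate directions, the one equal to the first
  argument contributes nothing to the |grad \<phi>|^2 term.\<close>

lemma sum_Basis_prod:
  fixes f :: "'a::euclidean_space \<times> 'b::euclidean_space \<Rightarrow> 'c::comm_monoid_add"
  shows "sum f Basis = (\<Sum>i\<in>Basis. f (i, 0)) + (\<Sum>j\<in>Basis. f (0, j))"
proof -
  have "inj_on (\<lambda>u. (u::'a, 0::'b)) Basis" "inj_on (\<lambda>u. (0::'a, u::'b)) Basis"
    by (auto intro!: inj_onI)
  then show ?thesis
    unfolding Basis_prod_def by (subst sum.union_disjoint) (auto simp: sum.reindex)
qed

lemma sum_Basis_inner_mult:
  fixes f :: "'a::euclidean_space \<Rightarrow> real"
  assumes "b \<in> Basis"
  shows "(\<Sum>c\<in>Basis. (b \<bullet> c) * f c) = f b" "(\<Sum>c\<in>Basis. (c \<bullet> b) * f c) = f b"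
  using assms by (simp_all add: inner_Basis if_distrib[of "\<lambda>x. x * _"] cong: if_cong)

lemma sum_sum_Basis_prod:
  fixes T :: "'a::euclidean_space \<times> 'b::euclidean_space \<Rightarrow> 'a \<times> 'b \<Rightarrow> 'c::comm_monoid_add"
  assumes "\<And>i b. i \<in> Basis \<Longrightarrow> b \<in> Basis \<Longrightarrow> T (i, 0) (0, b) = 0"
    and "\<And>i b. i \<in> Basis \<Longrightarrow> b \<in> Basis \<Longrightarrow> T (0, b) (i, 0) = 0"
  shows "(\<Sum>I\<in>Basis. \<Sum>J\<in>Basis. T I J) =
    (\<Sum>i\<in>Basis. \<Sum>j\<in>Basis. T (i, 0) (j, 0)) + (\<Sum>a\<in>Basis. \<Sum>b\<in>Basis. T (0, a) (0, b))"
  unfolding sum_Basis_prod by (simp add: assms)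

lemma linear_euclidean_expansion:
  fixes A :: "'e::euclidean_space \<Rightarrow> 'v::real_vector"
  assumes "linear A"
  shows "A w = (\<Sum>i\<in>Basis. (w \<bullet> i) *\<^sub>R A i)"
proof -
  have "A w = A (\<Sum>i\<in>Basis. (w \<bullet> i) *\<^sub>R i)" by (simp only: euclidean_representation)
  then show ?thesis using assms by (simp add: linear_sum linear_cmul)
qed

section \<open>Symmetry of second derivatives\<close>

text \<open>The mean value theorem is applied twice, along \<open>a\<close> and then along
  \<open>b\<close>. It turns the second difference quotient into the value of the mixed derivative
  \<open>Db\<close> at some point of the small parallelogram spanned by \<open>t a\<close> and
  \<open>t b\<close>, and \<open>Db\<close> is continuous at \<open>x\<close>. The quotient does not
  change when \<open>a\<close> and \<open>b\<close> are exchanged, which is why this quotient is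
  studied.\<close>

lemma second_difference_tendsto:
  fixes h :: "'e::euclidean_space \<Rightarrow> real"
  assumes S: "open S" "x \<in> S" and h: "Ck_on 2 S h"
  shows "((\<lambda>t. (h (x + t *\<^sub>R a + t *\<^sub>R b) - h (x + t *\<^sub>R a) - h (x + t *\<^sub>R b) + h x) / t\<^sup>2)
      \<longlongrightarrow> frechet_derivative (\<lambda>y. frechet_derivative h (at y) a) (at x) b) (at_right 0)"
proof -
  define Da where "Da = (\<lambda>y. frechet_derivative h (at y) a)"
  define Db where "Db y = frechet_derivative Da (at y) b" for y
  have dh: "\<And>y. y \<in> S \<Longrightarrow> (h has_derivative frechet_derivative h (at y)) (at y)"
    and da: "\<And>y. y \<in> S \<Longrightarrow> (Da has_derivative frechet_derivative Da (at y)) (at y)"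
    and cb: "continuous_on S Db"
    using h unfolding numeral_2_eq_2 Da_def Db_def[abs_def]
    by (simp_all add: frechet_derivative_works)
  have lin: "frechet_derivative h (at y) (c *\<^sub>R a) = c * Da y" if "y \<in> S" for y c
    using linear_cmul[OF has_derivative_linear[OF dh[OF that]], of c a] by (simp add: Da_def)
  have linb: "frechet_derivative Da (at y) (c *\<^sub>R b) = c * Db y" if "y \<in> S" for y c
    using linear_cmul[OF has_derivative_linear[OF da[OF that]], of c b] by (simp add: Db_def)
  obtain r where r: "r > 0" "ball x r \<subseteq> S"
    using S open_contains_ball by blast
  show ?thesis
    unfolding Da_def[symmetric] Db_def[symmetric]
  proof (rule tendstoI)
    fix e :: real assume e: "e > 0"
    have "continuous (at x) Db"
      using cb S by (simp add: continuous_on_eq_continuous_at)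
    then obtain d0 where d0: "d0 > 0" "\<And>y. dist y x < d0 \<Longrightarrow> dist (Db y) (Db x) < e"
      using e unfolding continuous_at_eps_delta by blast
    \<comment> \<open>With this \<open>d\<close>, every point of the parallelogram with parameters
      in [0, d) is within \<open>min r d0\<close> of \<open>x\<close>: inside \<open>S\<close>, and
      where \<open>Db\<close> is \<open>e\<close>-close to \<open>Db x\<close>. The summand 1 keeps
      the denominator positive when \<open>a\<close> and \<open>b\<close> are both zero.\<close>
    define d where "d = min r d0 / (norm a + norm b + 1)"
    have dpos: "d > 0"
      unfolding d_def using r(1) d0(1) by (intro divide_pos_pos) (auto simp: add_nonneg_pos)
    have near: "dist (x + s *\<^sub>R a + u *\<^sub>R b) x < min r d0"
      if "0 \<le> s" "0 \<le> u" "s < d" "u < d" for s u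
    proof -
      have "dist (x + s *\<^sub>R a + u *\<^sub>R b) x = norm (s *\<^sub>R a + u *\<^sub>R b)"
        by (simp add: dist_norm algebra_simps)
      also have "\<dots> \<le> s * norm a + u * norm b"
        using that by (metis norm_triangle_ineq norm_scaleR abs_of_nonneg)
      also have "\<dots> \<le> d * norm a + d * norm b"
        using that by (intro add_mono mult_right_mono) auto
      also have "\<dots> < d * (norm a + norm b + 1)"
        using dpos by (simp add: algebra_simps)
      also have "\<dots> = min r d0"
        unfolding d_def by (simp add: add_nonneg_eq_0_iff)
      finally show ?thesis .
    qed
    have inS: "x + s *\<^sub>R a + u *\<^sub>R b \<in> S" if "0 \<le> s" "0 \<le> u" "s < d" "u < d" for s u
      using near[OF that] r(2) by (auto simp: dist_commute)
    have main: "dist ((h (x + t *\<^sub>R a + t *\<^sub>R b) - h (x + t *\<^sub>R a) - h (x + t *\<^sub>R b) + h x) / t\<^sup>2) (Db x) < e"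
      if t: "0 < t" "t < d" for t
    proof -
      \<comment> \<open>Mean value theorem along \<open>a\<close> for the increment of
        \<open>h\<close> in direction \<open>t b\<close>. The zero multiples are kept so that the
        left side is literally the value at \<open>t\<close> minus the value at 0.\<close>
      have "\<exists>s>0. s < t \<and> (h (x + t *\<^sub>R a + t *\<^sub>R b) - h (x + t *\<^sub>R a + 0 *\<^sub>R b))
          - (h (x + 0 *\<^sub>R a + t *\<^sub>R b) - h (x + 0 *\<^sub>R a + 0 *\<^sub>R b))
          = (t - 0) * (Da (x + s *\<^sub>R a + t *\<^sub>R b) - Da (x + s *\<^sub>R a + 0 *\<^sub>R b))"
      proof (rule MVT2[OF t(1)])
        fix s :: real assume s: "0 \<le> s" "s \<le> t"
        have *: "((\<lambda>s. h (x + s *\<^sub>R a + u *\<^sub>R b)) has_derivative (\<lambda>c. c * Da (x + s *\<^sub>R a + u *\<^sub>R b))) (at s)"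
          if u: "0 \<le> u" "u < d" for u
        proof -
          have i: "x + s *\<^sub>R a + u *\<^sub>R b \<in> S" using s t u by (intro inS) auto
          have "((\<lambda>s. h (x + s *\<^sub>R a + u *\<^sub>R b)) has_derivative
              (\<lambda>c. frechet_derivative h (at (x + s *\<^sub>R a + u *\<^sub>R b)) (c *\<^sub>R a))) (at s)"
            by (rule has_derivative_compose[where f = "\<lambda>s. x + s *\<^sub>R a + u *\<^sub>R b", OF _ dh[OF i]])
              (auto intro!: derivative_eq_intros)
          then show ?thesis using lin[OF i] by simp
        qed
        show "((\<lambda>s. h (x + s *\<^sub>R a + t *\<^sub>R b) - h (x + s *\<^sub>R a + 0 *\<^sub>R b)) has_real_derivative
            Da (x + s *\<^sub>R a + t *\<^sub>R b) - Da (x + s *\<^sub>R a + 0 *\<^sub>R b)) (at s)"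
          using has_derivative_diff[OF *[of t] *[of 0]] t dpos
          by (auto simp: has_field_derivative_def fun_eq_iff algebra_simps elim!: has_derivative_eq_rhs)
      qed
      then obtain s where s: "0 < s" "s < t"
        "h (x + t *\<^sub>R a + t *\<^sub>R b) - h (x + t *\<^sub>R a) - h (x + t *\<^sub>R b) + h x
          = t * (Da (x + s *\<^sub>R a + t *\<^sub>R b) - Da (x + s *\<^sub>R a + 0 *\<^sub>R b))"
        by auto
      \<comment> \<open>Mean value theorem along \<open>b\<close>, now for \<open>Da\<close> with
        \<open>s\<close> fixed. The two factors \<open>t\<close> produce the denominator of the
        quotient.\<close>
      have "\<exists>u>0. u < t \<and> Da (x + s *\<^sub>R a + t *\<^sub>R b) - Da (x + s *\<^sub>R a + 0 *\<^sub>R b)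
          = (t - 0) * Db (x + s *\<^sub>R a + u *\<^sub>R b)"
      proof (rule MVT2[OF t(1)])
        fix u :: real assume u: "0 \<le> u" "u \<le> t"
        have i: "x + s *\<^sub>R a + u *\<^sub>R b \<in> S" using s t u by (intro inS) auto
        have "((\<lambda>u. Da (x + s *\<^sub>R a + u *\<^sub>R b)) has_derivative
              (\<lambda>c. frechet_derivative Da (at (x + s *\<^sub>R a + u *\<^sub>R b)) (c *\<^sub>R b))) (at u)"
          by (rule has_derivative_compose[where f = "\<lambda>u. x + s *\<^sub>R a + u *\<^sub>R b", OF _ da[OF i]])
            (auto intro!: derivative_eq_intros)
        then show "((\<lambda>u. Da (x + s *\<^sub>R a + u *\<^sub>R b)) has_real_derivative Db (x + s *\<^sub>R a + u *\<^sub>R b)) (at u)"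
          using linb[OF i] by (auto simp: has_field_derivative_def fun_eq_iff mult.commute elim!: has_derivative_eq_rhs)
      qed
      then obtain u where u: "0 < u" "u < t"
        "Da (x + s *\<^sub>R a + t *\<^sub>R b) - Da (x + s *\<^sub>R a + 0 *\<^sub>R b) = t * Db (x + s *\<^sub>R a + u *\<^sub>R b)"
        by auto
      have "(h (x + t *\<^sub>R a + t *\<^sub>R b) - h (x + t *\<^sub>R a) - h (x + t *\<^sub>R b) + h x) / t\<^sup>2
          = Db (x + s *\<^sub>R a + u *\<^sub>R b)"
        using s(3) u(3) t(1) by (simp add: power2_eq_square)
      then show ?thesis using d0(2) near[of s u] s u t by simp
    qed
    show "\<forall>\<^sub>F t in at_right 0. dist ((h (x + t *\<^sub>R a + t *\<^sub>R b) - h (x + t *\<^sub>R a) - h (x + t *\<^sub>R b) + h x) / t\<^sup>2) (Db x) < e"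
      using main dpos by (auto simp: eventually_at_right_field intro: exI[of _ d])
  qed
qed

lemma second_derivative_symmetric:
  fixes h :: "'e::euclidean_space \<Rightarrow> real"
  assumes "open S" "x \<in> S" "Ck_on 2 S h"
  shows "frechet_derivative (\<lambda>y. frechet_derivative h (at y) a) (at x) b
    = frechet_derivative (\<lambda>y. frechet_derivative h (at y) b) (at x) a"
proof (rule tendsto_unique[OF trivial_limit_at_right_real second_difference_tendsto[OF assms]])
  show "((\<lambda>t. (h (x + t *\<^sub>R a + t *\<^sub>R b) - h (x + t *\<^sub>R a) - h (x + t *\<^sub>R b) + h x) / t\<^sup>2)
      \<longlongrightarrow> frechet_derivative (\<lambda>y. frechet_derivative h (at y) b) (at x) a) (at_right 0)"
    using second_difference_tendsto[OF assms, of b a] by (simp add: algebra_simps)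
qed

section \<open>Differentiability of the solution of a linear system\<close>

text \<open>A product rule in which the second factor is merely continuous. As \<open>f\<close>
  vanishes at \<open>x\<close>, it is O(|y - x|), so \<open>f y\<close> times
  \<open>g y - g x\<close> is o(|y - x|) and \<open>g\<close> may be replaced by its value at
  \<open>x\<close>.\<close>

lemma has_derivative_scaleR_zero_left:
  fixes g :: "'e::real_normed_vector \<Rightarrow> 'v::real_normed_vector"
  assumes f: "(f has_derivative f') (at x)" and f0: "f x = 0" and g: "continuous (at x) g"
  shows "((\<lambda>y. f y *\<^sub>R g y) has_derivative (\<lambda>h. f' h *\<^sub>R g x)) (at x)"
proof -
  obtain K where K: "\<And>h. \<bar>f' h\<bar> \<le> norm h * K" and Kpos: "K > 0"
    using bounded_linear.pos_bounded[OF has_derivative_bounded_linear[OF f]] by auto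
  have "((\<lambda>y. f y *\<^sub>R (g y - g x)) has_derivative (\<lambda>h. 0)) (at x)"
    unfolding has_derivative_at_alt
  proof (intro conjI allI impI)
    fix e :: real assume e: "e > 0"
    obtain d1 where d1: "d1 > 0" "\<And>y. norm (y - x) < d1 \<Longrightarrow> norm (f y - f x - f' (y - x)) \<le> 1 * norm (y - x)"
      using f unfolding has_derivative_at_alt by (metis zero_less_one)
    obtain d2 where d2: "d2 > 0" "\<And>y. dist y x < d2 \<Longrightarrow> dist (g y) (g x) < e / (1 + K)"
      using g e Kpos unfolding continuous_at_eps_delta by (metis add_pos_pos divide_pos_pos zero_less_one)
    have "norm (f y *\<^sub>R (g y - g x)) \<le> e * norm (y - x)" if y: "norm (y - x) < min d1 d2" for y
    proof -
      have "\<bar>f y - f' (y - x)\<bar> \<le> norm (y - x)" using d1(2)[of y] y f0 by simp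
      then have "\<bar>f y\<bar> \<le> norm (y - x) * (1 + K)" using K[of "y - x"] by (simp add: algebra_simps)
      moreover have "norm (g y - g x) \<le> e / (1 + K)"
        using d2(2)[of y] y by (simp add: dist_norm less_imp_le)
      ultimately have "\<bar>f y\<bar> * norm (g y - g x) \<le> (norm (y - x) * (1 + K)) * (e / (1 + K))"
        by (intro mult_mono) auto
      also have "\<dots> = e * norm (y - x)" using Kpos by simp
      finally show ?thesis by simp
    qed
    then show "\<exists>d>0. \<forall>y. norm (y - x) < d \<longrightarrow>
        norm (f y *\<^sub>R (g y - g x) - f x *\<^sub>R (g x - g x) - 0) \<le> e * norm (y - x)"
      using d1(1) d2(1) f0 by (intro exI[of _ "min d1 d2"]) auto
  qed auto
  moreover have "((\<lambda>y. f y *\<^sub>R g x) has_derivative (\<lambda>h. f' h *\<^sub>R g x)) (at x)"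
    using f by (auto intro!: derivative_eq_intros)
  ultimately show ?thesis
    using has_derivative_add[of "\<lambda>y. f y *\<^sub>R g x" _ "at x" "\<lambda>y. f y *\<^sub>R (g y - g x)"]
    by (fastforce simp: algebra_simps)
qed

lemma has_derivative_cong_open:
  assumes "open S" "x \<in> S" "\<And>y. y \<in> S \<Longrightarrow> f y = g y"
  shows "(f has_derivative D) (at x) \<longleftrightarrow> (g has_derivative D) (at x)"
proof
  assume "(f has_derivative D) (at x)"
  then show "(g has_derivative D) (at x)"
    by (rule has_derivative_transform_within_open) (use assms in auto)
next
  assume "(g has_derivative D) (at x)"
  then show "(f has_derivative D) (at x)"
    by (rule has_derivative_transform_within_open) (use assms in auto)
qed

lemma differentiable_cong_open:
  assumes "open S" "x \<in> S" "\<And>y. y \<in> S \<Longrightarrow> f y = g y"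
  shows "f differentiable (at x) \<longleftrightarrow> g differentiable (at x)"
  unfolding differentiable_def using has_derivative_cong_open[of S x f g] assms by simp

lemma frechet_derivative_cong_open:
  assumes "open S" "x \<in> S" "\<And>y. y \<in> S \<Longrightarrow> f y = g y"
  shows "frechet_derivative f (at x) = frechet_derivative g (at x)"
  unfolding frechet_derivative_def using has_derivative_cong_open[of S x f g] assms by simp

text \<open>The injective map \<open>A x\<close> is bounded below by some \<open>K > 0\<close>, and
  \<open>E y\<close> bounds the operator norm of \<open>A y - A x\<close>. Once
  \<open>E y < K / 2\<close>, the error term can be absorbed into the lower bound, which gives |v y|
  at most 2 |l| / K. Then \<open>A x (v y - v x)\<close> equals \<open>- (A y - A x) (v y)\<close>,
  and a second use of the lower bound gives the rate 2 |l| E / K^2.\<close>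

lemma continuous_linear_solution:
  fixes A :: "'e::real_normed_vector \<Rightarrow> 'v::euclidean_space \<Rightarrow> 'v"
  assumes lin: "\<And>y. linear (A y)" and inj: "inj (A x)"
    and cont: "\<And>i. i \<in> Basis \<Longrightarrow> continuous (at x) (\<lambda>y. A y i)"
    and sol: "\<forall>\<^sub>F y in at x. A y (v y) = l" and solx: "A x (v x) = l"
  shows "continuous (at x) v"
proof -
  obtain K where K: "K > 0" "\<And>w. K * norm w \<le> norm (A x w)"
    using linear_inj_bounded_below_pos[OF lin inj] by (metis mult.commute)
  define E where "E = (\<lambda>y. \<Sum>i\<in>Basis. norm (A y i - A x i))"
  have E0: "(E \<longlongrightarrow> 0) (at x)"
  proof -
    have "(E \<longlongrightarrow> (\<Sum>i\<in>Basis. norm (A x i - A x (i::'v)))) (at x)"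
      unfolding E_def using cont by (intro tendsto_intros) (auto simp: continuous_at)
    then show ?thesis by simp
  qed
  have Eb: "norm (A y w - A x w) \<le> E y * norm w" for y w
  proof -
    have "A y w - A x w = (\<Sum>i\<in>Basis. (w \<bullet> i) *\<^sub>R (A y i - A x i))"
      by (simp only: linear_euclidean_expansion[OF lin, of _ w] scaleR_diff_right sum_subtractf)
    also have "norm \<dots> \<le> (\<Sum>i\<in>Basis. norm w * norm (A y i - A x i))"
      by (rule sum_norm_le) (auto intro!: mult_right_mono Basis_le_norm)
    finally show ?thesis by (simp add: E_def sum_distrib_left mult.commute)
  qed
  have "((\<lambda>y. 2 / K\<^sup>2 * norm l * E y + (norm l * 0) * 0) \<longlongrightarrow> 2 / K\<^sup>2 * norm l * 0 + (norm l * 0) * 0) (at x)"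
    by (intro tendsto_intros E0)
  then have lim: "((\<lambda>y. 2 / K\<^sup>2 * norm l * E y) \<longlongrightarrow> 0) (at x)" by simp
  have "\<forall>\<^sub>F y in at x. norm (v y - v x) \<le> 2 / K\<^sup>2 * norm l * E y"
  proof -
    have "\<forall>\<^sub>F y in at x. E y < K / 2"
      using order_tendstoD(2)[OF E0, of "K / 2"] K(1) by simp
    with sol show ?thesis
    proof eventually_elim
      case (elim y)
      have E: "E y \<ge> 0" unfolding E_def by (simp add: sum_nonneg)
      have "K * norm (v y) \<le> norm (A x (v y))" by (rule K)
      also have "\<dots> \<le> norm l + norm (A y (v y) - A x (v y))"
        using norm_triangle_ineq4[of "A y (v y)" "A y (v y) - A x (v y)"] elim(1) by simp
      also have "\<dots> \<le> norm l + E y * norm (v y)" using Eb[of y "v y"] by simp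
      also have "\<dots> \<le> norm l + K / 2 * norm (v y)"
        using elim(2) by (intro add_left_mono mult_right_mono) auto
      finally have vb: "norm (v y) \<le> 2 / K * norm l" using K(1) by (simp add: field_simps)
      have "K * norm (v y - v x) \<le> norm (A x (v y - v x))" by (rule K)
      also have "A x (v y - v x) = - (A y (v y) - A x (v y))"
        using elim(1) solx lin[of x] by (simp add: linear_diff)
      also have "norm \<dots> \<le> E y * norm (v y)" using Eb[of y "v y"] by (simp add: norm_minus_commute)
      also have "\<dots> \<le> E y * (2 / K * norm l)" using vb E by (intro mult_left_mono)
      finally show ?case using K(1) by (simp add: field_simps power2_eq_square)
    qed
  qed
  then have "((\<lambda>y. v y - v x) \<longlongrightarrow> 0) (at x)"
    by (rule Lim_null_comparison[OF _ lim])
  then show ?thesis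
    unfolding continuous_at by (simp add: LIM_zero_iff)
qed

text \<open>The solution satisfies \<open>v = v\<^sub>0 - A\<^sub>0\<inverse> (A - A\<^sub>0) v\<close>, where \<open>A - A\<^sub>0\<close> vanishes at \<open>x\<close>, so
  continuity of \<open>v\<close> already gives differentiability.\<close>

lemma differentiable_linear_solution:
  fixes A :: "'e::real_normed_vector \<Rightarrow> 'v::euclidean_space \<Rightarrow> 'v"
  assumes lin: "\<And>y. linear (A y)" and inj: "inj (A x)"
    and diff: "\<And>i j. i \<in> Basis \<Longrightarrow> j \<in> Basis \<Longrightarrow> (\<lambda>y. A y i \<bullet> j) differentiable (at x)"
    and T: "open T" "x \<in> T" and sol: "\<And>y. y \<in> T \<Longrightarrow> A y (v y) = l"
  shows "v differentiable (at x)"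
proof -
  obtain B where B: "linear B" "\<And>w. B (A x w) = w"
    using linear_injective_left_inverse[OF lin inj] by (auto simp: fun_eq_iff)
  have cont: "continuous (at x) v"
  proof (rule continuous_linear_solution[where A = A and l = l, OF lin inj])
    fix i :: 'v assume "i \<in> Basis"
    then have "(\<lambda>y. \<Sum>j\<in>Basis. (A y i \<bullet> j) *\<^sub>R j) differentiable (at x)"
      using diff by (intro derivative_intros) auto
    then show "isCont (\<lambda>y. A y i) x"
      by (simp add: euclidean_representation differentiable_imp_continuous_within)
  qed (use T sol in \<open>auto intro: eventually_at_in_open'[THEN eventually_mono]\<close>)
  have "(\<lambda>y. \<Sum>i\<in>Basis. \<Sum>j\<in>Basis. (A y i \<bullet> j - A x i \<bullet> j) *\<^sub>R ((v y \<bullet> i) *\<^sub>R B j)) differentiable (at x)"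
  proof (intro differentiable_sum finite_Basis ballI)
    fix i j :: 'v assume "i \<in> Basis" "j \<in> Basis"
    from diff[OF this] obtain D where "((\<lambda>y. A y i \<bullet> j) has_derivative D) (at x)"
      unfolding differentiable_def by blast
    then have "((\<lambda>y. A y i \<bullet> j - A x i \<bullet> j) has_derivative D) (at x)"
      using has_derivative_diff[OF _ has_derivative_const] by fastforce
    then have "((\<lambda>y. (A y i \<bullet> j - A x i \<bullet> j) *\<^sub>R ((v y \<bullet> i) *\<^sub>R B j)) has_derivative
        (\<lambda>h. D h *\<^sub>R ((v x \<bullet> i) *\<^sub>R B j))) (at x)"
      by (rule has_derivative_scaleR_zero_left) (use cont in \<open>auto intro!: continuous_intros\<close>)
    then show "(\<lambda>y. (A y i \<bullet> j - A x i \<bullet> j) *\<^sub>R ((v y \<bullet> i) *\<^sub>R B j)) differentiable (at x)"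
      by (rule differentiableI)
  qed
  then have "(\<lambda>y. B l - (\<Sum>i\<in>Basis. \<Sum>j\<in>Basis. (A y i \<bullet> j - A x i \<bullet> j) *\<^sub>R ((v y \<bullet> i) *\<^sub>R B j)))
      differentiable (at x)"
    by (rule differentiable_diff[OF differentiable_const])
  moreover have "B l - (\<Sum>i\<in>Basis. \<Sum>j\<in>Basis. (A y i \<bullet> j - A x i \<bullet> j) *\<^sub>R ((v y \<bullet> i) *\<^sub>R B j)) = v y"
    if "y \<in> T" for y
  proof -
    \<comment> \<open>The double sum with matrix entries of \<open>A z\<close> reassembles to
      \<open>B (A z (v y))\<close>. This is \<open>B l\<close> for \<open>z = y\<close> and
      \<open>v y\<close> for \<open>z = x\<close>, so the difference of the two is exactly what is
      subtracted from \<open>B l\<close>.\<close>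
    have r: "(\<Sum>i\<in>Basis. \<Sum>j\<in>Basis. (A z i \<bullet> j) *\<^sub>R ((v y \<bullet> i) *\<^sub>R B j)) = B (A z (v y))" for z
    proof -
      have "(\<Sum>j\<in>Basis. (A z i \<bullet> j) *\<^sub>R ((v y \<bullet> i) *\<^sub>R B j)) = (v y \<bullet> i) *\<^sub>R B (A z i)" for i
        unfolding linear_euclidean_expansion[OF B(1), of "A z i"]
        by (simp add: scaleR_sum_right mult.commute)
      then show ?thesis
        by (simp add: linear_euclidean_expansion[OF linear_compose[OF lin B(1), unfolded o_def], of z "v y"])
    qed
    show ?thesis
      by (simp only: scaleR_diff_left sum_subtractf r sol[OF that] B(2)) simp
  qed
  ultimately show ?thesis
    by (rule differentiable_cong_open[OF T, THEN iffD1, rotated])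
qed

section \<open>Smoothness of functions pulled back from a factor\<close>

lemma Ck_on_cong:
  assumes "open S" "\<And>y. y \<in> S \<Longrightarrow> f y = g y"
  shows "Ck_on k S f \<longleftrightarrow> Ck_on k S g"
  using assms(2)
proof (induction k arbitrary: f g)
  case 0
  then show ?case using continuous_on_cong[OF refl, of S f g] by simp
next
  case (Suc k)
  have "frechet_derivative f (at y) = frechet_derivative g (at y)" if "y \<in> S" for y
    by (rule frechet_derivative_cong_open[OF assms(1) that Suc.prems])
  then have "Ck_on k S (\<lambda>x. frechet_derivative f (at x) e) \<longleftrightarrow> Ck_on k S (\<lambda>x. frechet_derivative g (at x) e)" for e
    by (intro Suc.IH) simp
  moreover have "f differentiable (at y) \<longleftrightarrow> g differentiable (at y)" if "y \<in> S" for y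
    by (rule differentiable_cong_open[OF assms(1) that Suc.prems])
  ultimately show ?case by simp
qed

lemma has_derivative_compose_fst:
  "(h has_derivative D) (at (fst z)) \<Longrightarrow> ((\<lambda>z. h (fst z)) has_derivative (\<lambda>e. D (fst e))) (at z)"
  by (rule has_derivative_compose[of fst fst]) (rule has_derivative_fst[OF has_derivative_ident])

lemma has_derivative_compose_snd:
  "(h has_derivative D) (at (snd z)) \<Longrightarrow> ((\<lambda>z. h (snd z)) has_derivative (\<lambda>e. D (snd e))) (at z)"
  by (rule has_derivative_compose[of snd snd]) (rule has_derivative_snd[OF has_derivative_ident])

text \<open>The derivative in direction \<open>e\<close> is the derivative of \<open>h\<close> in
  direction \<open>fst e\<close>, again composed with \<open>fst\<close>; hence the induction over
  arbitrary \<open>h\<close>.\<close>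

lemma Ck_on_compose_fst:
  assumes "open S" "open T" "Ck_on k S h"
  shows "Ck_on k (S \<times> T) (\<lambda>z. h (fst z))"
  using assms(3)
proof (induction k arbitrary: h)
  case 0
  then have "continuous_on S h" by simp
  then have "continuous_on (S \<times> T) (\<lambda>z. h (fst z))"
    by (rule continuous_on_compose2) (auto intro: continuous_on_fst continuous_on_id)
  then show ?case by simp
next
  case (Suc k)
  have d: "((\<lambda>z. h (fst z)) has_derivative (\<lambda>e. frechet_derivative h (at (fst z)) (fst e))) (at z)"
    if "z \<in> S \<times> T" for z
    using Suc.prems that by (intro has_derivative_compose_fst) (auto simp: frechet_derivative_works)
  have "Ck_on k (S \<times> T) (\<lambda>z. frechet_derivative (\<lambda>z. h (fst z)) (at z) e)" for e
  proof (rule Ck_on_cong[THEN iffD1, OF open_Times[OF assms(1,2)]])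
    show "Ck_on k (S \<times> T) (\<lambda>z. frechet_derivative h (at (fst z)) (fst e))"
      using Suc.IH[of "\<lambda>x. frechet_derivative h (at x) (fst e)"] Suc.prems by simp
  qed (simp add: frechet_derivative_at[OF d, symmetric])
  then show ?case using d unfolding Ck_on.simps(2) by (blast intro: differentiableI)
qed

section \<open>Differentiation in charts\<close>

text \<open>The condition on which \<open>coord_vec\<close> branches, given a name so that the
  default value 0 can be tracked through sums, products and changes of chart.\<close>

definition differentiable_in :: "('a, 'e::euclidean_space) chart \<Rightarrow> 'a \<Rightarrow> ('a \<Rightarrow> real) \<Rightarrow> bool" where
  "differentiable_in c p h \<longleftrightarrow> (h \<circ> chart_inv c) differentiable (at (snd c p))"

lemma coord_vec_eqI:
  assumes "((h \<circ> chart_inv c) has_derivative D) (at (snd c p))"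
  shows "coord_vec c p e h = D e"
  using assms frechet_derivative_at[OF assms] by (auto simp: coord_vec_def intro: differentiableI)

lemma differentiable_in_has_derivative:
  assumes "differentiable_in c p h"
  shows "((h \<circ> chart_inv c) has_derivative (\<lambda>e. coord_vec c p e h)) (at (snd c p))"
  using assms by (simp add: differentiable_in_def coord_vec_def frechet_derivative_works)

text \<open>The default value 0 is also linear in the direction, so this is an identity of
  functionals on all functions.\<close>

lemma coord_vec_linear:
  "coord_vec c p (a *\<^sub>R d + b *\<^sub>R e) = (\<lambda>h. a * coord_vec c p d h + b * coord_vec c p e h)"
proof
  fix h show "coord_vec c p (a *\<^sub>R d + b *\<^sub>R e) h = a * coord_vec c p d h + b * coord_vec c p e h"
    using linear_frechet_derivative[of "h \<circ> chart_inv c" "at (snd c p)"]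
    by (simp add: coord_vec_def linear_add linear_cmul)
qed

lemma linear_coord_vec: "linear (\<lambda>e. coord_vec c p e h)"
  using coord_vec_linear[of c p 1 _ 1] coord_vec_linear[of c p _ _ 0 0]
  by (intro linearI) (simp_all add: fun_eq_iff)

lemma coord_vec_zero [simp]: "coord_vec c p 0 h = 0"
  using linear_0[OF linear_coord_vec] .

lemma coord_vec_zero_fun: "coord_vec c p 0 = (\<lambda>h. 0)"
  by (simp add: fun_eq_iff)

lemma coord_vec_expansion: "coord_vec c p e h = (\<Sum>i\<in>Basis. (e \<bullet> i) * coord_vec c p i h)"
  using linear_euclidean_expansion[OF linear_coord_vec[of c p h], of e] by simp

lemma differentiable_in_const [simp]: "differentiable_in c p (\<lambda>q. r)"
  by (simp add: differentiable_in_def o_def)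

lemma differentiable_in_add:
  "differentiable_in c p h \<Longrightarrow> differentiable_in c p k \<Longrightarrow> differentiable_in c p (\<lambda>q. h q + k q)"
  by (simp add: differentiable_in_def o_def)

lemma differentiable_in_mult:
  "differentiable_in c p h \<Longrightarrow> differentiable_in c p k \<Longrightarrow> differentiable_in c p (\<lambda>q. h q * k q)"
  by (simp add: differentiable_in_def o_def)

lemma differentiable_in_sum:
  "finite I \<Longrightarrow> (\<And>i. i \<in> I \<Longrightarrow> differentiable_in c p (h i)) \<Longrightarrow> differentiable_in c p (\<lambda>q. \<Sum>i\<in>I. h i q)"
  by (simp add: differentiable_in_def o_def)

lemma coord_vec_const [simp]: "coord_vec c p e (\<lambda>q. r) = 0"
  by (rule coord_vec_eqI) (simp add: o_def)

lemma coord_vec_sum: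
  "(\<And>i. i \<in> I \<Longrightarrow> differentiable_in c p (h i)) \<Longrightarrow>
    coord_vec c p e (\<lambda>q. \<Sum>i\<in>I. h i q) = (\<Sum>i\<in>I. coord_vec c p e (h i))"
  by (rule coord_vec_eqI)
    (auto simp: o_def intro!: has_derivative_sum differentiable_in_has_derivative[unfolded o_def])

text \<open>For \<open>r\<close> nonzero, \<open>h\<close> and its multiple are differentiable
  together, so outside the differentiable case both sides are the default 0. For
  \<open>r = 0\<close> the function on the left is constant.\<close>

lemma coord_vec_cmult:
  "coord_vec c p e (\<lambda>q. r * h q) = r * coord_vec c p e h"
proof (cases "differentiable_in c p h \<or> r = 0")
  case True
  then show ?thesis
    by (cases "r = 0")
      (auto simp: o_def intro!: coord_vec_eqI has_derivative_mult_right dest!: differentiable_in_has_derivative)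
next
  case False
  then have "\<not> differentiable_in c p (\<lambda>q. r * h q)"
    using differentiable_in_mult[of c p "\<lambda>q. inverse r" "\<lambda>q. r * h q"] by (auto simp: field_simps)
  with False show ?thesis by (simp add: coord_vec_def differentiable_in_def)
qed

text \<open>The calculus in a single chart rests on these two properties: injectivity makes
  \<open>chart_inv\<close> a left inverse on the domain, and openness of the image makes derivatives
  depend only on values inside the domain.\<close>

locale regular_chart =
  fixes c :: "('a, 'e::euclidean_space) chart"
  assumes inj_chart: "inj_on (snd c) (fst c)"
    and open_chart: "open (snd c ` fst c)"
begin

lemma chart_inv_apply [simp]: "p \<in> fst c \<Longrightarrow> chart_inv c (snd c p) = p"
  by (simp add: chart_inv_def inj_chart)

lemma differentiable_in_cong:
  assumes "p \<in> fst c" "\<And>q. q \<in> fst c \<Longrightarrow> h q = k q"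
  shows "differentiable_in c p h \<longleftrightarrow> differentiable_in c p k"
  unfolding differentiable_in_def
  by (rule differentiable_cong_open[OF open_chart]) (use assms in auto)

lemma coord_vec_cong:
  assumes "p \<in> fst c" "\<And>q. q \<in> fst c \<Longrightarrow> h q = k q"
  shows "coord_vec c p e h = coord_vec c p e k"
proof -
  have "frechet_derivative (h \<circ> chart_inv c) (at (snd c p)) = frechet_derivative (k \<circ> chart_inv c) (at (snd c p))"
    by (rule frechet_derivative_cong_open[OF open_chart]) (use assms in auto)
  then show ?thesis
    using differentiable_in_cong[OF assms] by (simp add: coord_vec_def differentiable_in_def)
qed

lemma coord_vec_eq_0:
  assumes "p \<in> fst c" "\<And>q. q \<in> fst c \<Longrightarrow> h q = 0"
  shows "coord_vec c p e h = 0"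
  using coord_vec_cong[OF assms] by simp

lemma coord_vec_mult:
  "p \<in> fst c \<Longrightarrow> differentiable_in c p h \<Longrightarrow> differentiable_in c p k \<Longrightarrow>
    coord_vec c p e (\<lambda>q. h q * k q) = coord_vec c p e h * k p + h p * coord_vec c p e k"
  using coord_vec_eqI[of "\<lambda>q. h q * k q" c, unfolded o_def,
      OF has_derivative_mult[OF differentiable_in_has_derivative[unfolded o_def] differentiable_in_has_derivative[unfolded o_def]]]
  by simp

lemma differentiable_in_divide:
  "p \<in> fst c \<Longrightarrow> differentiable_in c p h \<Longrightarrow> differentiable_in c p k \<Longrightarrow> k p \<noteq> 0 \<Longrightarrow>
    differentiable_in c p (\<lambda>q. h q / k q)"
  by (simp add: differentiable_in_def o_def)

lemma coord_vec_divide: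
  assumes "p \<in> fst c" "differentiable_in c p h" "differentiable_in c p k" "k p \<noteq> 0"
  shows "coord_vec c p e (\<lambda>q. h q / k q) = coord_vec c p e h / k p - h p * coord_vec c p e k / (k p)\<^sup>2"
proof -
  have "((\<lambda>x. h (chart_inv c x) / k (chart_inv c x)) has_derivative
      (\<lambda>e. - h p * (inverse (k p) * coord_vec c p e k * inverse (k p)) + coord_vec c p e h / k p)) (at (snd c p))"
    using has_derivative_divide[OF differentiable_in_has_derivative[OF assms(2), unfolded o_def]
        differentiable_in_has_derivative[OF assms(3), unfolded o_def]] assms by simp
  then have "coord_vec c p e (\<lambda>q. h q / k q) =
      - h p * (inverse (k p) * coord_vec c p e k * inverse (k p)) + coord_vec c p e h / k p"
    by (intro coord_vec_eqI) (simp add: o_def)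
  then show ?thesis using assms(4) by (simp add: field_simps power2_eq_square)
qed

lemma coord_vec_coord [simp]:
  assumes p: "p \<in> fst c"
  shows "coord_vec c p e (\<lambda>q. snd c q \<bullet> i) = e \<bullet> i"
proof -
  have "((\<lambda>x. x \<bullet> i) has_derivative (\<lambda>e. e \<bullet> i)) (at (snd c p))"
    by (intro derivative_eq_intros) auto
  then have "(((\<lambda>q. snd c q \<bullet> i) \<circ> chart_inv c) has_derivative (\<lambda>e. e \<bullet> i)) (at (snd c p))"
    by (rule has_derivative_transform_within_open[OF _ open_chart]) (use p in auto)
  then show ?thesis by (rule coord_vec_eqI)
qed

lemma vec_comp_coord_vec [simp]: "p \<in> fst c \<Longrightarrow> vec_comp c (coord_vec c p e) i = e \<bullet> i"
  by (simp add: vec_comp_def)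

lemma coord_vec_inject: "p \<in> fst c \<Longrightarrow> coord_vec c p d = coord_vec c p e \<longleftrightarrow> d = e"
  using coord_vec_coord by (metis euclidean_eqI)

text \<open>Change of charts: both transition maps have to be differentiable, because a function which is
  differentiable in one chart only would have different derivatives in the two charts.\<close>

lemma coord_vec_change:
  assumes "regular_chart c'" and p: "p \<in> fst c" "p \<in> fst c'"
    and op: "open (snd c ` (fst c \<inter> fst c'))" "open (snd c' ` (fst c \<inter> fst c'))"
    and d1: "(snd c \<circ> chart_inv c') differentiable (at (snd c' p))"
    and d2: "(snd c' \<circ> chart_inv c) differentiable (at (snd c p))"
  shows "coord_vec c' p e = coord_vec c p (frechet_derivative (snd c \<circ> chart_inv c') (at (snd c' p)) e)"
proof
  fix h
  interpret c': regular_chart c' by fact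
  define D where "D = frechet_derivative (snd c \<circ> chart_inv c') (at (snd c' p))"
  have D: "((\<lambda>x. snd c (chart_inv c' x)) has_derivative D) (at (snd c' p))"
    using d1 by (simp add: D_def frechet_derivative_works o_def)
  have fwd: "((h \<circ> chart_inv c') has_derivative (\<lambda>e. coord_vec c p (D e) h)) (at (snd c' p))"
    if "differentiable_in c p h"
  proof -
    have "((\<lambda>x. (h \<circ> chart_inv c) (snd c (chart_inv c' x))) has_derivative (\<lambda>e. coord_vec c p (D e) h)) (at (snd c' p))"
      by (rule has_derivative_compose[OF D]) (use differentiable_in_has_derivative[OF that] p in \<open>simp add: o_def\<close>)
    then show ?thesis
      by (rule has_derivative_transform_within_open[OF _ op(2)]) (use p in auto)
  qed
  have bwd: "differentiable_in c p h" if "differentiable_in c' p h"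
  proof -
    obtain D' where D': "((\<lambda>x. snd c' (chart_inv c x)) has_derivative D') (at (snd c p))"
      using d2 by (auto simp: differentiable_def o_def)
    have "((\<lambda>x. (h \<circ> chart_inv c') (snd c' (chart_inv c x))) has_derivative (\<lambda>e. coord_vec c' p (D' e) h)) (at (snd c p))"
      by (rule has_derivative_compose[OF D']) (use differentiable_in_has_derivative[OF that] p in \<open>simp add: o_def\<close>)
    then have "((h \<circ> chart_inv c) has_derivative (\<lambda>e. coord_vec c' p (D' e) h)) (at (snd c p))"
      by (rule has_derivative_transform_within_open[OF _ op(1)]) (use p in auto)
    then show ?thesis by (auto simp: differentiable_in_def intro: differentiableI)
  qed
  show "coord_vec c' p e h = coord_vec c p (D e) h"
  proof (cases "differentiable_in c p h")
    case True
    show ?thesis by (rule coord_vec_eqI[OF fwd[OF True]])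
  next
    case False
    then have "\<not> differentiable_in c' p h" using bwd by blast
    with False show ?thesis by (simp add: coord_vec_def differentiable_in_def)
  qed
qed

text \<open>In coordinates \<open>\<pi>\<close> is the linear map \<open>L\<close>, and
  \<open>s\<close> is a section of \<open>L\<close> through the image of \<open>p\<close>. The chain
  rule along \<open>L\<close> differentiates \<open>h \<circ> \<pi>\<close>. Conversely, composing
  the coordinate form of \<open>h \<circ> \<pi>\<close> with \<open>s\<close> recovers that of
  \<open>h\<close>, so differentiability upstairs forces differentiability downstairs. The formula
  for \<open>coord_vec\<close> therefore also covers functions for which both sides take the default
  0.\<close>

lemma coord_vec_submersion:
  assumes "regular_chart c'" and p: "p \<in> fst c" and L: "bounded_linear L"
    and eq: "\<And>x. x \<in> snd c ` fst c \<Longrightarrow> \<pi> (chart_inv c x) = chart_inv c' (L x)"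
    and sec: "(s has_derivative s') (at (L (snd c p)))" "s (L (snd c p)) = snd c p"
      "\<And>y. y \<in> snd c' ` fst c' \<Longrightarrow> s y \<in> snd c ` fst c" "\<And>y. L (s y) = y"
    and pi: "\<pi> p \<in> fst c'" "snd c' (\<pi> p) = L (snd c p)"
  shows "differentiable_in c p (\<lambda>z. h (\<pi> z)) \<longleftrightarrow> differentiable_in c' (\<pi> p) h" (is ?diff)
    and "coord_vec c p e (\<lambda>z. h (\<pi> z)) = coord_vec c' (\<pi> p) (L e) h" (is ?coord)
proof -
  interpret c': regular_chart c' by fact
  have fwd: "(((\<lambda>z. h (\<pi> z)) \<circ> chart_inv c) has_derivative (\<lambda>e. coord_vec c' (\<pi> p) (L e) h)) (at (snd c p))"
    if "differentiable_in c' (\<pi> p) h"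
  proof -
    have "((\<lambda>x. (h \<circ> chart_inv c') (L x)) has_derivative (\<lambda>e. coord_vec c' (\<pi> p) (L e) h)) (at (snd c p))"
      by (rule has_derivative_compose[OF bounded_linear_imp_has_derivative[OF L]])
        (use differentiable_in_has_derivative[OF that] pi in \<open>simp add: o_def\<close>)
    then show ?thesis
      by (rule has_derivative_transform_within_open[OF _ open_chart]) (use p eq in auto)
  qed
  have bwd: "differentiable_in c' (\<pi> p) h" if "differentiable_in c p (\<lambda>z. h (\<pi> z))"
  proof -
    have "((\<lambda>y. ((\<lambda>z. h (\<pi> z)) \<circ> chart_inv c) (s y)) has_derivative (\<lambda>e. coord_vec c p (s' e) (\<lambda>z. h (\<pi> z))))
        (at (L (snd c p)))"
      by (rule has_derivative_compose[OF sec(1)]) (use differentiable_in_has_derivative[OF that] sec(2) in \<open>simp add: o_def\<close>)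
    then have "((h \<circ> chart_inv c') has_derivative (\<lambda>e. coord_vec c p (s' e) (\<lambda>z. h (\<pi> z)))) (at (L (snd c p)))"
      by (rule has_derivative_transform_within_open[OF _ c'.open_chart])
        (use pi(1) pi(2)[symmetric] sec(3,4) eq in auto)
    then show ?thesis using pi(2) by (auto simp: differentiable_in_def intro: differentiableI)
  qed
  show ?diff using fwd bwd by (auto simp: differentiable_in_def intro: differentiableI)
  show ?coord
  proof (cases "differentiable_in c' (\<pi> p) h")
    case True
    show ?thesis by (rule coord_vec_eqI[OF fwd[OF True]])
  next
    case False
    then show ?thesis using \<open>?diff\<close> by (simp add: coord_vec_def differentiable_in_def)
  qed
qed

end

section \<open>Product charts and their two projections\<close>

definition prod_chart :: "('a, 'e) chart \<Rightarrow> ('b, 'f) chart \<Rightarrow> ('a \<times> 'b, 'e \<times> 'f) chart" where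
  "prod_chart c d = (fst c \<times> fst d, map_prod (snd c) (snd d))"

lemma fst_prod_chart [simp]: "fst (prod_chart c d) = fst c \<times> fst d"
  and snd_prod_chart [simp]: "snd (prod_chart c d) = map_prod (snd c) (snd d)"
  by (simp_all add: prod_chart_def)

locale chart_pair = c: regular_chart c + d: regular_chart d
  for c :: "('a, 'e::euclidean_space) chart" and d :: "('b, 'f::euclidean_space) chart"

sublocale chart_pair \<subseteq> cd: regular_chart "prod_chart c d"
proof
  show "inj_on (snd (prod_chart c d)) (fst (prod_chart c d))"
    using c.inj_chart d.inj_chart by (simp add: map_prod_inj_on)
  show "open (snd (prod_chart c d) ` fst (prod_chart c d))"
    using c.open_chart d.open_chart by (simp add: map_prod_surj_on[OF refl refl] open_Times)
qed

context chart_pair begin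

lemma image_prod_chart: "snd (prod_chart c d) ` (X \<times> Y) = (snd c ` X) \<times> (snd d ` Y)"
  by (simp add: map_prod_surj_on[OF refl refl])

lemma chart_inv_prod_chart:
  assumes "x \<in> snd c ` fst c" "y \<in> snd d ` fst d"
  shows "chart_inv (prod_chart c d) (x, y) = (chart_inv c x, chart_inv d y)"
proof -
  have "chart_inv (prod_chart c d) (snd (prod_chart c d) (chart_inv c x, chart_inv d y)) = (chart_inv c x, chart_inv d y)"
    by (rule cd.chart_inv_apply) (use assms in auto)
  then show ?thesis using assms by auto
qed

lemma differentiable_in_fst:
    "p \<in> fst c \<Longrightarrow> q \<in> fst d \<Longrightarrow> differentiable_in (prod_chart c d) (p, q) (\<lambda>z. h (fst z)) \<longleftrightarrow> differentiable_in c p h"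
  and coord_vec_fst:
    "p \<in> fst c \<Longrightarrow> q \<in> fst d \<Longrightarrow> coord_vec (prod_chart c d) (p, q) e (\<lambda>z. h (fst z)) = coord_vec c p (fst e) h"
proof -
  assume pq: "p \<in> fst c" "q \<in> fst d"
  have 1: "fst (chart_inv (prod_chart c d) z) = chart_inv c (fst z)"
    if "z \<in> snd (prod_chart c d) ` fst (prod_chart c d)" for z
    using that by (auto simp: chart_inv_prod_chart)
  \<comment> \<open>The section is the slice through the coordinates of \<open>(p, q)\<close> on
    which the second coordinate is frozen.\<close>
  have 2: "((\<lambda>x. (x, snd d q)) has_derivative (\<lambda>e. (e, 0))) (at (fst (snd (prod_chart c d) (p, q))))"
    by (auto intro!: derivative_eq_intros)
  have 3: "(\<lambda>x. (x, snd d q)) y \<in> snd (prod_chart c d) ` fst (prod_chart c d)" if "y \<in> snd c ` fst c" for y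
    using that pq by (force simp: map_prod_surj_on[OF refl refl])
  show "differentiable_in (prod_chart c d) (p, q) (\<lambda>z. h (fst z)) \<longleftrightarrow> differentiable_in c p h"
    using cd.coord_vec_submersion(1)[OF c.regular_chart_axioms _ bounded_linear_fst 1 2 _ 3, of h] pq by simp
  show "coord_vec (prod_chart c d) (p, q) e (\<lambda>z. h (fst z)) = coord_vec c p (fst e) h"
    using cd.coord_vec_submersion(2)[OF c.regular_chart_axioms _ bounded_linear_fst 1 2 _ 3, of e h] pq by simp
qed

lemma differentiable_in_snd:
    "p \<in> fst c \<Longrightarrow> q \<in> fst d \<Longrightarrow> differentiable_in (prod_chart c d) (p, q) (\<lambda>z. h (snd z)) \<longleftrightarrow> differentiable_in d q h"
  and coord_vec_snd:
    "p \<in> fst c \<Longrightarrow> q \<in> fst d \<Longrightarrow> coord_vec (prod_chart c d) (p, q) e (\<lambda>z. h (snd z)) = coord_vec d q (snd e) h"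
proof -
  assume pq: "p \<in> fst c" "q \<in> fst d"
  have 1: "snd (chart_inv (prod_chart c d) z) = chart_inv d (snd z)"
    if "z \<in> snd (prod_chart c d) ` fst (prod_chart c d)" for z
    using that by (auto simp: chart_inv_prod_chart)
  have 2: "((\<lambda>y. (snd c p, y)) has_derivative (\<lambda>e. (0, e))) (at (snd (snd (prod_chart c d) (p, q))))"
    by (auto intro!: derivative_eq_intros)
  have 3: "(\<lambda>y. (snd c p, y)) y \<in> snd (prod_chart c d) ` fst (prod_chart c d)" if "y \<in> snd d ` fst d" for y
    using that pq by (force simp: map_prod_surj_on[OF refl refl])
  show "differentiable_in (prod_chart c d) (p, q) (\<lambda>z. h (snd z)) \<longleftrightarrow> differentiable_in d q h"
    using cd.coord_vec_submersion(1)[OF d.regular_chart_axioms _ bounded_linear_snd 1 2 _ 3, of h] pq by simp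
  show "coord_vec (prod_chart c d) (p, q) e (\<lambda>z. h (snd z)) = coord_vec d q (snd e) h"
    using cd.coord_vec_submersion(2)[OF d.regular_chart_axioms _ bounded_linear_snd 1 2 _ 3, of e h] pq by simp
qed

end

section \<open>Riemannian metrics in charts\<close>

lemma smooth_on_imp_Ck: "smooth_on S h \<Longrightarrow> Ck_on k S h"
  by (simp add: smooth_on_def)

lemma smooth_on_imp_differentiable: "smooth_on S h \<Longrightarrow> x \<in> S \<Longrightarrow> h differentiable (at x)"
  using smooth_on_imp_Ck[of S h "Suc 0"] by simp

section \<open>Tangent spaces and changes of chart\<close>

text \<open>One direction of a coordinate change, to first order. Holding it for both
  \<open>c d\<close> and \<open>d c\<close> supplies the premises of
  \<open>coord_vec_change\<close>, and it passes from pairs of charts to their product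
  charts.\<close>

definition compatible_charts ::
  "('a, 'e::euclidean_space) chart \<Rightarrow> ('a, 'e) chart \<Rightarrow> bool" where
  "compatible_charts c d \<longleftrightarrow> open (snd c ` (fst c \<inter> fst d)) \<and>
     (\<forall>p\<in>fst c \<inter> fst d. (snd d \<circ> chart_inv c) differentiable (at (snd c p)))"

lemma smooth_manifold_regular_chart:
  assumes M: "smooth_manifold M" and c: "c \<in> atlas M"
  shows "regular_chart c"
proof
  have op: "openin (mtop M) (fst c)"
    and h: "homeomorphic_map (subtopology (mtop M) (fst c)) (top_of_set (snd c ` fst c)) (snd c)"
    using assms by (auto simp: smooth_manifold_def)
  then have "topspace (subtopology (mtop M) (fst c)) = fst c"
    by (simp add: openin_subset Int_absorb1 topspace_subtopology)
  then show "inj_on (snd c) (fst c)" using homeomorphic_imp_injective_map[OF h] by simp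
  show "open (snd c ` fst c)" using assms by (auto simp: smooth_manifold_def)
qed

lemma smooth_manifold_chart_subset: "smooth_manifold M \<Longrightarrow> c \<in> atlas M \<Longrightarrow> fst c \<subseteq> points M"
  by (auto simp: smooth_manifold_def)

lemma smooth_manifold_compatible_charts:
  assumes M: "smooth_manifold M" and cd: "c \<in> atlas M" "d \<in> atlas M"
  shows "compatible_charts c d"
  unfolding compatible_charts_def
proof
  have h: "homeomorphic_map (subtopology (mtop M) (fst c)) (top_of_set (snd c ` fst c)) (snd c)"
    and op: "openin (mtop M) (fst d)" and oc: "open (snd c ` fst c)"
    using assms by (auto simp: smooth_manifold_def)
  have "openin (subtopology (mtop M) (fst c)) (fst c \<inter> fst d)"
    using op by (simp add: openin_subtopology_Int2)
  with homeomorphic_imp_open_map[OF h]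
  have "openin (top_of_set (snd c ` fst c)) (snd c ` (fst c \<inter> fst d))"
    by (simp add: open_map_def)
  then show "open (snd c ` (fst c \<inter> fst d))" using oc openin_open_eq by blast
  have "smooth_on (snd c ` (fst c \<inter> fst d)) (snd d \<circ> chart_inv c)"
    using assms by (auto simp: smooth_manifold_def)
  then show "\<forall>p\<in>fst c \<inter> fst d. (snd d \<circ> chart_inv c) differentiable (at (snd c p))"
    using smooth_on_imp_differentiable by blast
qed

lemma range_coord_vec_subset:
  assumes "regular_chart c" "regular_chart d" "compatible_charts c d" "compatible_charts d c"
    and p: "p \<in> fst c" "p \<in> fst d"
  shows "range (coord_vec d p) \<subseteq> range (coord_vec c p)"
  using regular_chart.coord_vec_change[OF assms(1,2) p] assms(3,4) p
  by (auto simp: compatible_charts_def Int_commute)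

text \<open>\<open>tangent_space\<close> collects coordinate vectors from every chart around
  \<open>p\<close>. The Jacobian of a change of charts rewrites each of them in the one chart
  \<open>c\<close>.\<close>

lemma tangent_space_eq_range:
  assumes c: "c \<in> atlas M" "p \<in> fst c"
    and reg: "\<And>d. d \<in> atlas M \<Longrightarrow> regular_chart d"
    and comp: "\<And>d d'. d \<in> atlas M \<Longrightarrow> d' \<in> atlas M \<Longrightarrow> compatible_charts d d'"
  shows "tangent_space M p = range (coord_vec c p)"
  unfolding tangent_space_def using range_coord_vec_subset[of c _ p] assms by blast

lemma (in chart_pair) compatible_prod_chart:
  assumes "compatible_charts c c'" "compatible_charts d d'"
  shows "compatible_charts (prod_chart c d) (prod_chart c' d')"
  unfolding compatible_charts_def
proof
  have eq: "fst (prod_chart c d) \<inter> fst (prod_chart c' d') = (fst c \<inter> fst c') \<times> (fst d \<inter> fst d')"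
    by auto
  show "open (snd (prod_chart c d) ` (fst (prod_chart c d) \<inter> fst (prod_chart c' d')))"
    unfolding eq image_prod_chart using assms by (auto simp: compatible_charts_def intro: open_Times)
  show "\<forall>z\<in>fst (prod_chart c d) \<inter> fst (prod_chart c' d').
      (snd (prod_chart c' d') \<circ> chart_inv (prod_chart c d)) differentiable (at (snd (prod_chart c d) z))"
  proof safe
    fix p q assume pq: "(p, q) \<in> fst (prod_chart c d)" "(p, q) \<in> fst (prod_chart c' d')"
    obtain D1 where D1: "((snd c' \<circ> chart_inv c) has_derivative D1) (at (snd c p))"
      using assms(1) pq by (auto simp: compatible_charts_def differentiable_def)
    obtain D2 where D2: "((snd d' \<circ> chart_inv d) has_derivative D2) (at (snd d q))"
      using assms(2) pq by (auto simp: compatible_charts_def differentiable_def)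
    have "((\<lambda>z. ((snd c' \<circ> chart_inv c) (fst z), (snd d' \<circ> chart_inv d) (snd z))) has_derivative
        (\<lambda>e. (D1 (fst e), D2 (snd e)))) (at (snd (prod_chart c d) (p, q)))"
      by (intro has_derivative_Pair has_derivative_compose_fst has_derivative_compose_snd) (use D1 D2 in \<open>auto simp: o_def\<close>)
    then have "((snd (prod_chart c' d') \<circ> chart_inv (prod_chart c d)) has_derivative
        (\<lambda>e. (D1 (fst e), D2 (snd e)))) (at (snd (prod_chart c d) (p, q)))"
      by (rule has_derivative_transform_within_open[OF _ cd.open_chart])
        (use pq in \<open>auto simp: chart_inv_prod_chart\<close>)
    then show "(snd (prod_chart c' d') \<circ> chart_inv (prod_chart c d)) differentiable
        (at (snd (prod_chart c d) (p, q)))" by (rule differentiableI)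
  qed
qed

context regular_chart begin

lemma smooth_differentiable_in:
  "smooth_on (snd c ` fst c) (h \<circ> chart_inv c) \<Longrightarrow> p \<in> fst c \<Longrightarrow> differentiable_in c p h"
  by (simp add: differentiable_in_def smooth_on_imp_differentiable)

text \<open>On the open image of the chart, \<open>coord_vec\<close> of a smooth function is its
  ordinary directional derivative, so existence of the next derivative and the exchange of order
  carry over from Euclidean space.\<close>

lemma smooth_differentiable_in_coord_vec:
  assumes h: "smooth_on (snd c ` fst c) (h \<circ> chart_inv c)" and p: "p \<in> fst c"
  shows "differentiable_in c p (\<lambda>q. coord_vec c q e h)"
    and "coord_vec c p e (\<lambda>q. coord_vec c q e' h) = coord_vec c p e' (\<lambda>q. coord_vec c q e h)"
proof -
  let ?D = "\<lambda>e x. frechet_derivative (h \<circ> chart_inv c) (at x) e"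
  have eq: "((\<lambda>q. coord_vec c q e h) \<circ> chart_inv c) x = ?D e x" if "x \<in> snd c ` fst c" for x e
    using that smooth_on_imp_differentiable[OF h that] by (auto simp: coord_vec_def)
  have C2: "Ck_on 2 (snd c ` fst c) (h \<circ> chart_inv c)" using h by (rule smooth_on_imp_Ck)
  have "?D e differentiable (at (snd c p))" for e
    using C2 p by (simp add: numeral_2_eq_2)
  then have D: "(?D e has_derivative frechet_derivative (?D e) (at (snd c p))) (at (snd c p))" for e
    by (simp only: frechet_derivative_works)
  have deriv: "(((\<lambda>q. coord_vec c q e h) \<circ> chart_inv c) has_derivative
      frechet_derivative (?D e) (at (snd c p))) (at (snd c p))" for e
    using has_derivative_cong_open[OF open_chart imageI[OF p] eq, THEN iffD2, OF _ D] .
  show "differentiable_in c p (\<lambda>q. coord_vec c q e h)"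
    unfolding differentiable_in_def by (rule differentiableI[OF deriv])
  have c: "coord_vec c p e (\<lambda>q. coord_vec c q e' h) = frechet_derivative (?D e') (at (snd c p)) e" for e e'
    by (rule coord_vec_eqI[OF deriv])
  show "coord_vec c p e (\<lambda>q. coord_vec c q e' h) = coord_vec c p e' (\<lambda>q. coord_vec c q e h)"
    unfolding c by (rule second_derivative_symmetric[OF open_chart _ C2]) (use p in auto)
qed

end

section \<open>Inverse metric, gradient, Hessian and Lie derivative in one chart\<close>

text \<open>The Riemannian conditions in coordinate form: pointwise linear algebra, plus one
  derivative of the components. The locale is instantiated for the base, for the fibre and for the
  warped metric, so general facts on gradients apply to all three.\<close>

locale metric_chart = regular_chart c
  for c :: "('a, 'e::euclidean_space) chart" +
  fixes M :: "('a, 'e) manifold" and g :: "'a tensor2"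
  assumes tangent: "p \<in> fst c \<Longrightarrow> tangent_space M p = range (coord_vec c p)"
    and metric_comp_sym: "p \<in> fst c \<Longrightarrow> metric_comp g c d e p = metric_comp g c e d p"
    and metric_comp_lin: "p \<in> fst c \<Longrightarrow>
      metric_comp g c (a *\<^sub>R d + b *\<^sub>R e) w p = a * metric_comp g c d w p + b * metric_comp g c e w p"
    and metric_comp_pos: "p \<in> fst c \<Longrightarrow> e \<noteq> 0 \<Longrightarrow> metric_comp g c e e p > 0"
    and metric_comp_differentiable: "p \<in> fst c \<Longrightarrow> i \<in> Basis \<Longrightarrow> j \<in> Basis \<Longrightarrow>
      differentiable_in c p (metric_comp g c i j)"

lemma riemannian_metric_chart:
  assumes g: "riemannian_manifold M g" and c: "c \<in> atlas M"
  shows "metric_chart c M g"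
proof -
  have M: "smooth_manifold M" using g by (simp add: riemannian_manifold_def)
  interpret regular_chart c using smooth_manifold_regular_chart[OF M c] .
  have t: "tangent_space M p = range (coord_vec c p)" if "p \<in> fst c" for p
    by (rule tangent_space_eq_range[OF c that])
      (use M smooth_manifold_regular_chart smooth_manifold_compatible_charts in blast)+
  have P: "g p (coord_vec c p d) (coord_vec c p e) = g p (coord_vec c p e) (coord_vec c p d)"
      "g p (\<lambda>h. a * coord_vec c p d h + b * coord_vec c p e h) (coord_vec c p w)
         = a * g p (coord_vec c p d) (coord_vec c p w) + b * g p (coord_vec c p e) (coord_vec c p w)"
      "coord_vec c p e \<noteq> (\<lambda>h. 0) \<Longrightarrow> g p (coord_vec c p e) (coord_vec c p e) > 0"
    if "p \<in> fst c" for p d e w a b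
    using g that t[OF that] smooth_manifold_chart_subset[OF M c]
    unfolding riemannian_manifold_def by blast+
  show ?thesis
  proof
    fix p assume p: "p \<in> fst c"
    show "tangent_space M p = range (coord_vec c p)" using t[OF p] .
    show "metric_comp g c d e p = metric_comp g c e d p" for d e
      using P(1)[OF p] by (simp add: metric_comp_def)
    show "metric_comp g c (a *\<^sub>R d + b *\<^sub>R e) w p = a * metric_comp g c d w p + b * metric_comp g c e w p" for a b d e w
      using P(2)[OF p] by (simp add: metric_comp_def coord_vec_linear)
    show "metric_comp g c e e p > 0" if "e \<noteq> 0" for e
      using P(3)[OF p, of e] that coord_vec_inject[OF p, of e 0]
      by (simp add: metric_comp_def coord_vec_zero_fun)
    show "differentiable_in c p (metric_comp g c i j)" if "i \<in> Basis" "j \<in> Basis" for i j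
      using g c that p by (intro smooth_differentiable_in) (auto simp: riemannian_manifold_def metric_comp_def[abs_def])
  qed
qed

text \<open>The coordinates g^{kl} \<partial>_l u of the gradient, written as a solution of a linear
  system with matrix \<open>metric_op\<close>. Unlike the description in \<open>grad\<close>, this
  vector can be differentiated componentwise.\<close>

definition grad_vec :: "'a tensor2 \<Rightarrow> ('a, 'e::euclidean_space) chart \<Rightarrow> ('a \<Rightarrow> real) \<Rightarrow> 'a \<Rightarrow> 'e" where
  "grad_vec g c u p = inv (metric_op g c p) (\<Sum>l\<in>Basis. coord_vec c p l u *\<^sub>R l)"

lemma linear_metric_op: "linear (metric_op g c p)"
  by (rule linearI)
    (simp_all add: metric_op_def inner_add_left distrib_left scaleR_add_left sum.distrib
      scaleR_sum_right mult.left_commute)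

lemma metric_op_Basis_inner:
  assumes "i \<in> Basis" "j \<in> Basis"
  shows "metric_op g c p i \<bullet> j = metric_comp g c j i p"
proof -
  have "metric_op g c p i = (\<Sum>a\<in>Basis. metric_comp g c a i p *\<^sub>R a)"
    unfolding metric_op_def using assms(1)
    by (intro sum.cong refl)
      (simp add: inner_Basis if_distrib[of "\<lambda>x. _ * x"] if_distrib[of "\<lambda>x. x *\<^sub>R _"] cong: if_cong)
  then show ?thesis using assms(2) by (simp add: inner_sum_left_Basis)
qed

context metric_chart begin

lemma linear_metric_comp:
  assumes "p \<in> fst c"
  shows "linear (\<lambda>d. metric_comp g c d e p)" "linear (\<lambda>d. metric_comp g c e d p)"
proof -
  show l: "linear (\<lambda>d. metric_comp g c d e p)"
    using metric_comp_lin[OF assms, of 1 _ 1 _ e] metric_comp_lin[OF assms, of _ _ 0 0 e]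
    by (intro linearI) auto
  then show "linear (\<lambda>d. metric_comp g c e d p)"
    using metric_comp_sym[OF assms] by simp
qed

lemma metric_comp_zero [simp]:
  "p \<in> fst c \<Longrightarrow> metric_comp g c 0 e p = 0" "p \<in> fst c \<Longrightarrow> metric_comp g c e 0 p = 0"
  using linear_metric_comp linear_0 by blast+

lemma metric_comp_expansion:
  assumes "p \<in> fst c"
  shows "metric_comp g c d e p = (\<Sum>i\<in>Basis. (d \<bullet> i) * metric_comp g c i e p)"
    and "metric_comp g c d e p = (\<Sum>i\<in>Basis. (e \<bullet> i) * metric_comp g c d i p)"
  using linear_euclidean_expansion[OF linear_metric_comp(1)[OF assms], of d e]
    linear_euclidean_expansion[OF linear_metric_comp(2)[OF assms], of d e] by simp_all

lemma metric_comp_expansion2: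
  assumes "p \<in> fst c"
  shows "metric_comp g c d e p = (\<Sum>i\<in>Basis. \<Sum>j\<in>Basis. metric_comp g c i j p * (d \<bullet> i) * (e \<bullet> j))"
  by (subst metric_comp_expansion(1)[OF assms], subst metric_comp_expansion(2)[OF assms])
    (simp add: sum_distrib_left mult_ac)

lemma metric_op_inner:
  assumes "p \<in> fst c"
  shows "metric_op g c p e \<bullet> d = metric_comp g c d e p"
proof -
  have "metric_op g c p e \<bullet> d = (\<Sum>j\<in>Basis. \<Sum>i\<in>Basis. (d \<bullet> j) * ((e \<bullet> i) * metric_comp g c j i p))"
    by (subst linear_euclidean_expansion[OF linear_metric_op], subst euclidean_representation[of d, symmetric])
      (simp add: inner_sum_left inner_sum_right metric_op_Basis_inner sum_distrib_left mult_ac)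
  also have "\<dots> = (\<Sum>j\<in>Basis. (d \<bullet> j) * metric_comp g c j e p)"
    by (simp add: metric_comp_expansion(2)[OF assms, of _ e] sum_distrib_left)
  also have "\<dots> = metric_comp g c d e p"
    by (rule metric_comp_expansion(1)[OF assms, symmetric])
  finally show ?thesis .
qed

text \<open>Pairing the image of \<open>e\<close> with \<open>e\<close> itself gives the metric at
  \<open>e\<close>, so positive definiteness leaves no kernel.\<close>

lemma inj_metric_op: "p \<in> fst c \<Longrightarrow> inj (metric_op g c p)"
  using metric_op_inner metric_comp_pos
  by (subst linear_injective_0[OF linear_metric_op]) (metis inner_zero_left less_irrefl)

lemma bij_metric_op: "p \<in> fst c \<Longrightarrow> bij (metric_op g c p)"
  using inj_metric_op linear_injective_imp_surjective[OF linear_metric_op inj_metric_op] by (simp add: bij_def)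

lemma metric_op_inv [simp]: "p \<in> fst c \<Longrightarrow> metric_op g c p (inv (metric_op g c p) l) = l"
  using bij_metric_op by (simp add: bij_is_surj surj_f_inv_f)

lemma inv_metric_op [simp]: "p \<in> fst c \<Longrightarrow> inv (metric_op g c p) (metric_op g c p e) = e"
  using inj_metric_op by simp

lemma inv_metric_op_eqI: "p \<in> fst c \<Longrightarrow> metric_op g c p e = l \<Longrightarrow> inv (metric_op g c p) l = e"
  using inv_metric_op by blast

lemma linear_inv_metric_op: "p \<in> fst c \<Longrightarrow> linear (inv (metric_op g c p))"
  by (intro linearI inv_metric_op_eqI)
    (simp_all add: linear_add[OF linear_metric_op] linear_cmul[OF linear_metric_op])

lemma metric_inv_sym:
  assumes "p \<in> fst c"
  shows "metric_inv g c k l p = metric_inv g c l k p"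
proof -
  let ?I = "inv (metric_op g c p)"
  have "?I l \<bullet> metric_op g c p (?I k) = metric_op g c p (?I l) \<bullet> ?I k"
    using metric_op_inner[OF assms] metric_comp_sym[OF assms] by (simp only: inner_commute)
  then show ?thesis using assms by (simp add: metric_inv_def inner_commute)
qed

lemma metric_inv_metric_comp:
  assumes "p \<in> fst c"
  shows "(\<Sum>l\<in>Basis. metric_inv g c k l p * metric_comp g c l e p) = e \<bullet> k"
proof -
  have "inv (metric_op g c p) (metric_op g c p e) \<bullet> k
      = (\<Sum>l\<in>Basis. (metric_op g c p e \<bullet> l) * metric_inv g c k l p)"
    by (subst linear_euclidean_expansion[OF linear_inv_metric_op[OF assms(1)]])
      (simp add: inner_sum_left metric_inv_def)
  then show ?thesis using assms by (simp add: metric_op_inner mult.commute)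
qed

lemma metric_inv_zero [simp]:
  "p \<in> fst c \<Longrightarrow> metric_inv g c 0 l p = 0" "p \<in> fst c \<Longrightarrow> metric_inv g c k 0 p = 0"
  by (simp_all add: metric_inv_def linear_0[OF linear_inv_metric_op])

lemma metric_comp_differentiable':
  assumes p: "p \<in> fst c"
  shows "differentiable_in c p (metric_comp g c d e)"
proof -
  show ?thesis
    by (subst differentiable_in_cong[OF p metric_comp_expansion2])
      (use p in \<open>auto intro!: differentiable_in_sum differentiable_in_mult metric_comp_differentiable\<close>)
qed

text \<open>The image of \<open>l\<close> under the inverse solves a linear system whose matrix
  entries are the differentiable metric components, so \<open>differentiable_linear_solution\<close>
  applies.\<close>

lemma metric_inv_differentiable:
  assumes p: "p \<in> fst c"
  shows "differentiable_in c p (metric_inv g c k l)"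
proof -
  have "(\<lambda>y. inv (metric_op g c (chart_inv c y)) l) differentiable (at (snd c p))"
  proof (rule differentiable_linear_solution[OF linear_metric_op _ _ open_chart])
    show "inj (metric_op g c (chart_inv c (snd c p)))" using p by (simp add: inj_metric_op)
    show "(\<lambda>y. metric_op g c (chart_inv c y) i \<bullet> j) differentiable (at (snd c p))"
      if "i \<in> Basis" "j \<in> Basis" for i j
      using metric_comp_differentiable[OF p that(2,1)] that
      by (simp add: metric_op_Basis_inner differentiable_in_def o_def)
  qed (use p in auto)
  then obtain D where "((\<lambda>y. inv (metric_op g c (chart_inv c y)) l) has_derivative D) (at (snd c p))"
    unfolding differentiable_def ..
  from has_derivative_inner_left[OF this, of k]
  have "(\<lambda>y. inv (metric_op g c (chart_inv c y)) l \<bullet> k) differentiable (at (snd c p))"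
    by (rule differentiableI)
  then show ?thesis by (simp add: differentiable_in_def metric_inv_def o_def)
qed

lemma grad_vec_inner:
  "p \<in> fst c \<Longrightarrow> grad_vec g c u p \<bullet> k = (\<Sum>l\<in>Basis. metric_inv g c k l p * coord_vec c p l u)"
  by (subst grad_vec_def, subst linear_euclidean_expansion[OF linear_inv_metric_op])
    (auto simp: inner_sum_left metric_inv_def mult.commute)

lemma metric_comp_grad_vec:
  assumes p: "p \<in> fst c"
  shows "metric_comp g c (grad_vec g c u p) e p = coord_vec c p e u"
proof -
  let ?d = "\<Sum>l\<in>Basis. coord_vec c p l u *\<^sub>R l"
  have "metric_op g c p (grad_vec g c u p) = ?d" using p by (simp add: grad_vec_def)
  then have "metric_comp g c e (grad_vec g c u p) p = ?d \<bullet> e"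
    using metric_op_inner[OF p, of "grad_vec g c u p" e] by simp
  also have "\<dots> = coord_vec c p e u"
    unfolding coord_vec_expansion[of c p e u] by (simp only: inner_sum_left inner_scaleR_left) (simp add: mult.commute inner_commute)
  finally show ?thesis using metric_comp_sym[OF p] by simp
qed

text \<open>\<open>metric_comp_grad_vec\<close> shows that this vector represents the differential.
  For uniqueness, the difference of two representing vectors pairs to zero with itself, and the
  metric is definite.\<close>

lemma grad_eq:
  assumes p: "p \<in> fst c"
  shows "grad M g u p = coord_vec c p (grad_vec g c u p)"
  unfolding grad_def tangent[OF p]
proof (rule the_equality)
  show "coord_vec c p (grad_vec g c u p) \<in> range (coord_vec c p) \<and>
      (\<forall>w\<in>range (coord_vec c p). g p (coord_vec c p (grad_vec g c u p)) w = w u)"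
    using metric_comp_grad_vec[OF p, of u] by (auto simp: metric_comp_def)
next
  fix v assume v: "v \<in> range (coord_vec c p) \<and> (\<forall>w\<in>range (coord_vec c p). g p v w = w u)"
  then obtain e where e: "v = coord_vec c p e" by auto
  let ?d = "e - grad_vec g c u p"
  have "metric_comp g c ?d ?d p = metric_comp g c e ?d p - metric_comp g c (grad_vec g c u p) ?d p"
    using linear_diff[OF linear_metric_comp(1)[OF p]] .
  also have "\<dots> = 0"
    using v e metric_comp_grad_vec[OF p, of u ?d] by (simp add: metric_comp_def)
  finally have "?d = 0" using metric_comp_pos[OF p, of ?d] by force
  then show "v = coord_vec c p (grad_vec g c u p)" using e by simp
qed

lemma grad_apply: "p \<in> fst c \<Longrightarrow> grad M g u p h = (\<Sum>k\<in>Basis. (grad_vec g c u p \<bullet> k) * coord_vec c p k h)"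
  by (simp add: grad_eq coord_vec_expansion[of c p "grad_vec g c u p"])

lemma grad_vec_differentiable:
  assumes p: "p \<in> fst c" and u: "smooth_on (snd c ` fst c) (u \<circ> chart_inv c)"
  shows "differentiable_in c p (\<lambda>q. grad_vec g c u q \<bullet> k)"
proof -
  have "differentiable_in c p (\<lambda>q. \<Sum>l\<in>Basis. metric_inv g c k l q * coord_vec c q l u)"
    by (intro differentiable_in_sum finite_Basis differentiable_in_mult metric_inv_differentiable
      smooth_differentiable_in_coord_vec(1) assms)
  then show ?thesis
    by (simp only: differentiable_in_cong[OF p grad_vec_inner])
qed

lemma coord_vec_metric_comp_sym:
  "p \<in> fst c \<Longrightarrow> coord_vec c p e (metric_comp g c i j) = coord_vec c p e (metric_comp g c j i)"
  by (rule coord_vec_cong) (auto intro: metric_comp_sym)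

lemma christoffel_sym: "p \<in> fst c \<Longrightarrow> christoffel g c k i j p = christoffel g c k j i p"
  by (simp add: christoffel_def coord_vec_metric_comp_sym[of p _ i j] add.commute)

text \<open>The inverse metric in the Christoffel symbol raises the index of the differential, which
  turns it into the gradient. In this form the Hessian can be compared termwise with the Lie
  derivative.\<close>

lemma christoffel_coord_vec:
  assumes p: "p \<in> fst c"
  shows "(\<Sum>k\<in>Basis. christoffel g c k i j p * coord_vec c p k u) =
    (\<Sum>l\<in>Basis. (grad_vec g c u p \<bullet> l) *
      (coord_vec c p i (metric_comp g c j l) + coord_vec c p j (metric_comp g c i l)
         - coord_vec c p l (metric_comp g c i j))) / 2"
proof -
  let ?T = "\<lambda>l. coord_vec c p i (metric_comp g c j l) + coord_vec c p j (metric_comp g c i l)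
         - coord_vec c p l (metric_comp g c i j)"
  have "(\<Sum>k\<in>Basis. christoffel g c k i j p * coord_vec c p k u)
      = (\<Sum>k\<in>Basis. \<Sum>l\<in>Basis. metric_inv g c l k p * coord_vec c p k u * ?T l) / 2"
    unfolding christoffel_def sum_divide_distrib sum_distrib_right
    by (intro sum.cong refl) (simp add: metric_inv_sym[OF p] mult_ac)
  also have "\<dots> = (\<Sum>l\<in>Basis. \<Sum>k\<in>Basis. metric_inv g c l k p * coord_vec c p k u * ?T l) / 2"
    by (subst sum.swap) simp
  also have "\<dots> = (\<Sum>l\<in>Basis. (grad_vec g c u p \<bullet> l) * ?T l) / 2"
    by (simp add: grad_vec_inner[OF p] sum_distrib_right)
  finally show ?thesis .
qed

text \<open>Let X be the gradient. Differentiating \<partial>_j u = sum_k X^k g_kj along i, and the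
  same identity with i and j exchanged along j, expresses both mixed second derivatives; they are
  equal by symmetry. In their sum minus twice the Christoffel term, the terms X^k \<partial>_i g_jk
  and X^k \<partial>_j g_ik cancel, and what remains is the coordinate formula of the Lie
  derivative.\<close>

lemma lie_deriv_grad:
  assumes p: "p \<in> fst c" and u: "smooth_on (snd c ` fst c) (u \<circ> chart_inv c)"
  shows "lie_deriv g c (grad M g u) p v w = 2 * hess g c u p v w"
proof -
  let ?X = "\<lambda>k q. grad_vec g c u q \<bullet> k"
  have X: "vec_comp c (grad M g u q) k = ?X k q" if "q \<in> fst c" for q k
    using that by (simp add: grad_eq)
  have DX: "coord_vec c p i (\<lambda>q. vec_comp c (grad M g u q) k) = coord_vec c p i (?X k)" for i k
    by (rule coord_vec_cong[OF p]) (rule X)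
  have ij: "coord_vec c p i (\<lambda>q. coord_vec c q j u)
      = (\<Sum>k\<in>Basis. ?X k p * coord_vec c p i (metric_comp g c j k) + metric_comp g c k j p * coord_vec c p i (?X k))"
    if "i \<in> Basis" "j \<in> Basis" for i j
  proof -
    have "coord_vec c p i (\<lambda>q. coord_vec c q j u) = coord_vec c p i (\<lambda>q. \<Sum>k\<in>Basis. ?X k q * metric_comp g c k j q)"
      by (rule coord_vec_cong[OF p]) (simp only: metric_comp_grad_vec[symmetric] metric_comp_expansion(1)[where d = "grad_vec g c u _"])
    also have "\<dots> = (\<Sum>k\<in>Basis. coord_vec c p i (\<lambda>q. ?X k q * metric_comp g c k j q))"
      using that p u by (intro coord_vec_sum differentiable_in_mult grad_vec_differentiable metric_comp_differentiable)
    also have "\<dots> = (\<Sum>k\<in>Basis. coord_vec c p i (?X k) * metric_comp g c k j p + ?X k p * coord_vec c p i (metric_comp g c k j))"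
      using that p u by (intro sum.cong refl coord_vec_mult grad_vec_differentiable metric_comp_differentiable)
    finally show ?thesis
      by (simp add: coord_vec_metric_comp_sym[OF p, of _ _ j] algebra_simps)
  qed
  have comp: "(\<Sum>k\<in>Basis. ?X k p * coord_vec c p k (metric_comp g c i j)
           + metric_comp g c k j p * coord_vec c p i (?X k)
           + metric_comp g c i k p * coord_vec c p j (?X k))
    = 2 * (coord_vec c p i (\<lambda>q. coord_vec c q j u) - (\<Sum>k\<in>Basis. christoffel g c k i j p * coord_vec c p k u))"
    (is "?L = 2 * (?uij - ?\<Gamma>)") if "i \<in> Basis" "j \<in> Basis" for i j
  proof -
    have "2 * (?uij - ?\<Gamma>) = coord_vec c p i (\<lambda>q. coord_vec c q j u) + coord_vec c p j (\<lambda>q. coord_vec c q i u) - 2 * ?\<Gamma>"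
      using smooth_differentiable_in_coord_vec(2)[OF u p, of i j] by simp
    also have "\<dots> = ?L"
      unfolding ij[OF that] ij[OF that(2,1)] christoffel_coord_vec[OF p]
      by (simp add: sum.distrib[symmetric] sum_subtractf[symmetric] metric_comp_sym[OF p, of _ i] algebra_simps)
    finally show ?thesis by simp
  qed
  show ?thesis
    unfolding lie_deriv_def hess_def DX X[OF p] sum_distrib_left[of 2]
    by (intro sum.cong refl) (simp only: comp mult.assoc)
qed

end

section \<open>Warped products\<close>

context chart_pair begin

lemma smooth_on_compose_fst:
  assumes h: "smooth_on (snd c ` fst c) (h \<circ> chart_inv c)"
  shows "smooth_on (snd (prod_chart c d) ` fst (prod_chart c d)) ((h \<circ> fst) \<circ> chart_inv (prod_chart c d))"
  unfolding smooth_on_def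
proof
  fix k
  have "Ck_on k ((snd c ` fst c) \<times> (snd d ` fst d)) (\<lambda>z. (h \<circ> chart_inv c) (fst z))"
    using h by (intro Ck_on_compose_fst c.open_chart d.open_chart smooth_on_imp_Ck)
  then show "Ck_on k (snd (prod_chart c d) ` fst (prod_chart c d)) ((h \<circ> fst) \<circ> chart_inv (prod_chart c d))"
    unfolding fst_prod_chart image_prod_chart
    by (rule Ck_on_cong[THEN iffD1, rotated 2])
      (auto intro: open_Times c.open_chart d.open_chart simp: chart_inv_prod_chart)
qed

lemma pushforward_fst:
  "p \<in> fst c \<Longrightarrow> q \<in> fst d \<Longrightarrow> pushforward fst (coord_vec (prod_chart c d) (p, q) e) = coord_vec c p (fst e)"
  by (simp add: pushforward_def fun_eq_iff o_def coord_vec_fst)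

lemma pushforward_snd:
  "p \<in> fst c \<Longrightarrow> q \<in> fst d \<Longrightarrow> pushforward snd (coord_vec (prod_chart c d) (p, q) e) = coord_vec d q (snd e)"
  by (simp add: pushforward_def fun_eq_iff o_def coord_vec_snd)

text \<open>Christoffel symbols of the product are known through closed formulas on the product of
  the chart domains. This rule and its companions below differentiate a function given by such a
  formula.\<close>

lemma coord_vec_fstI:
  assumes "p \<in> fst c" "q \<in> fst d" "\<And>p' q'. p' \<in> fst c \<Longrightarrow> q' \<in> fst d \<Longrightarrow> h (p', q') = A p'"
  shows "coord_vec (prod_chart c d) (p, q) e h = coord_vec c p (fst e) A"
  unfolding coord_vec_fst[OF assms(1,2), symmetric] by (rule cd.coord_vec_cong) (use assms in auto)

lemma coord_vec_sndI:
  assumes "p \<in> fst c" "q \<in> fst d" "\<And>p' q'. p' \<in> fst c \<Longrightarrow> q' \<in> fst d \<Longrightarrow> h (p', q') = K q'"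
  shows "coord_vec (prod_chart c d) (p, q) e h = coord_vec d q (snd e) K"
  unfolding coord_vec_snd[OF assms(1,2), symmetric] by (rule cd.coord_vec_cong) (use assms in auto)

lemma coord_vec_zeroI:
  assumes "p \<in> fst c" "q \<in> fst d" "\<And>p' q'. p' \<in> fst c \<Longrightarrow> q' \<in> fst d \<Longrightarrow> h (p', q') = 0"
  shows "coord_vec (prod_chart c d) (p, q) e h = 0"
  by (rule cd.coord_vec_eq_0) (use assms in auto)

lemma coord_vec_multI:
  assumes "p \<in> fst c" "q \<in> fst d"
    and h: "\<And>p' q'. p' \<in> fst c \<Longrightarrow> q' \<in> fst d \<Longrightarrow> h (p', q') = A p' * K q'"
    and d: "differentiable_in c p A" "differentiable_in d q K"
  shows "coord_vec (prod_chart c d) (p, q) e h = coord_vec c p (fst e) A * K q + A p * coord_vec d q (snd e) K"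
proof -
  have "coord_vec (prod_chart c d) (p, q) e h = coord_vec (prod_chart c d) (p, q) e (\<lambda>z. A (fst z) * K (snd z))"
    by (rule cd.coord_vec_cong) (use assms in auto)
  also have "\<dots> = coord_vec c p (fst e) A * K q + A p * coord_vec d q (snd e) K"
    by (subst cd.coord_vec_mult) (use assms in \<open>auto simp: differentiable_in_fst differentiable_in_snd coord_vec_fst coord_vec_snd\<close>)
  finally show ?thesis .
qed

end

section \<open>Metric, inverse metric and Christoffel symbols of the warped product\<close>

text \<open>\<open>N\<close> stays abstract here: what \<open>grad N\<close> reads off it is the
  tangent space, prescribed by \<open>tangent_N\<close> through the product chart.\<close>

locale warped_charts = B: metric_chart c B gB + F: metric_chart d F gF
  for c :: "('a, 'b::euclidean_space) chart" and B gB
    and d :: "('c, 'd::euclidean_space) chart" and F gF +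
  fixes \<phi> :: "'a \<Rightarrow> real" and N :: "('a \<times> 'c, 'b \<times> 'd) manifold"
  assumes phi_smooth: "smooth_on (snd c ` fst c) (\<phi> \<circ> chart_inv c)"
    and phi_pos: "p \<in> fst c \<Longrightarrow> \<phi> p > 0"
    and tangent_N: "p \<in> fst c \<Longrightarrow> q \<in> fst d \<Longrightarrow>
      tangent_space N (p, q) = range (coord_vec (prod_chart c d) (p, q))"

sublocale warped_charts \<subseteq> chart_pair c d ..

context warped_charts begin

abbreviation "G \<equiv> warped_metric \<phi> gB gF"
abbreviation "cd \<equiv> prod_chart c d"

lemma phi_nonzero [simp]: "p \<in> fst c \<Longrightarrow> \<phi> p \<noteq> 0"
  using phi_pos by fastforce

lemma phi_differentiable: "p \<in> fst c \<Longrightarrow> differentiable_in c p \<phi>"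
  using B.smooth_differentiable_in[OF phi_smooth] .

lemma metric_comp_warped:
  "p \<in> fst c \<Longrightarrow> q \<in> fst d \<Longrightarrow> metric_comp G cd e e' (p, q) =
    metric_comp gB c (fst e) (fst e') p + (\<phi> p)\<^sup>2 * metric_comp gF d (snd e) (snd e') q"
  by (simp add: metric_comp_def warped_metric_def pushforward_fst pushforward_snd)

lemma metric_comp_warped_simps:
  assumes "p \<in> fst c" "q \<in> fst d"
  shows "metric_comp G cd (i, 0) (j, 0) (p, q) = metric_comp gB c i j p"
    "metric_comp G cd (i, 0) (0, b) (p, q) = 0"
    "metric_comp G cd (0, a) (j, 0) (p, q) = 0"
    "metric_comp G cd (0, a) (0, b) (p, q) = (\<phi> p)\<^sup>2 * metric_comp gF d a b q"
  using assms by (simp_all add: metric_comp_warped)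

lemma coord_vec_phi_sq: "p \<in> fst c \<Longrightarrow> coord_vec c p e (\<lambda>p. (\<phi> p)\<^sup>2) = 2 * \<phi> p * coord_vec c p e \<phi>"
  using B.coord_vec_mult[of p \<phi> \<phi> e] phi_differentiable by (simp add: power2_eq_square)

lemma phi_sq_differentiable: "p \<in> fst c \<Longrightarrow> differentiable_in c p (\<lambda>p. (\<phi> p)\<^sup>2)"
  using differentiable_in_mult[of c p \<phi> \<phi>] phi_differentiable by (simp add: power2_eq_square)

lemma coord_vec_metric_comp_warped:
  assumes "p \<in> fst c" "q \<in> fst d"
  shows "coord_vec cd (p, q) e (metric_comp G cd (i, 0) (j, 0)) = coord_vec c p (fst e) (metric_comp gB c i j)"
    "coord_vec cd (p, q) e (metric_comp G cd (i, 0) (0, b)) = 0"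
    "coord_vec cd (p, q) e (metric_comp G cd (0, a) (j, 0)) = 0"
    "coord_vec cd (p, q) e (metric_comp G cd (0, a) (0, b)) =
      2 * \<phi> p * coord_vec c p (fst e) \<phi> * metric_comp gF d a b q
      + (\<phi> p)\<^sup>2 * coord_vec d q (snd e) (metric_comp gF d a b)"
  using assms
  by (simp_all add: coord_vec_fstI coord_vec_zeroI metric_comp_warped_simps coord_vec_phi_sq[symmetric])
    (rule coord_vec_multI; simp add: metric_comp_warped_simps phi_sq_differentiable F.metric_comp_differentiable')

text \<open>This makes the gradient, Christoffel symmetry and \<open>lie_deriv_grad\<close>
  available for the warped metric itself.\<close>

sublocale N: metric_chart cd N G
proof
  fix z assume "z \<in> fst cd"
  then obtain p q where z: "z = (p, q)" and pq: "p \<in> fst c" "q \<in> fst d" by auto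
  show "tangent_space N z = range (coord_vec cd z)" using tangent_N pq z by simp
  show "metric_comp G cd e e' z = metric_comp G cd e' e z" for e e'
    using pq z B.metric_comp_sym F.metric_comp_sym by (simp add: metric_comp_warped)
  show "metric_comp G cd (a *\<^sub>R e + b *\<^sub>R e') w z = a * metric_comp G cd e w z + b * metric_comp G cd e' w z" for a b e e' w
    using pq z by (simp add: metric_comp_warped B.metric_comp_lin F.metric_comp_lin algebra_simps)
  show "metric_comp G cd e e z > 0" if "e \<noteq> 0" for e
  proof -
    \<comment> \<open>A nonzero vector may have one vanishing projection, so each block is only
      nonnegative; strictness comes from whichever projection is nonzero.\<close>
    have "metric_comp gB c (fst e) (fst e) p \<ge> 0" "metric_comp gF d (snd e) (snd e) q \<ge> 0"
      using B.metric_comp_pos[OF pq(1), of "fst e"] F.metric_comp_pos[OF pq(2), of "snd e"] pq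
      by (cases "fst e = 0", auto) (cases "snd e = 0", auto)
    moreover have "fst e \<noteq> 0 \<or> snd e \<noteq> 0" using that by (auto simp: prod_eq_iff)
    ultimately show ?thesis
      using pq z B.metric_comp_pos[OF pq(1), of "fst e"] F.metric_comp_pos[OF pq(2), of "snd e"] phi_pos[OF pq(1)]
      by (auto simp: metric_comp_warped intro: add_pos_nonneg add_nonneg_pos)
  qed
  fix e e' :: "'b \<times> 'd"
  have "differentiable_in cd (p, q) (\<lambda>z. metric_comp gB c (fst e) (fst e') (fst z)
      + (\<phi> (fst z))\<^sup>2 * metric_comp gF d (snd e) (snd e') (snd z))"
    by (intro differentiable_in_add differentiable_in_mult)
      (use pq in \<open>simp_all add: differentiable_in_fst differentiable_in_fst[where h = "\<lambda>p. (\<phi> p)\<^sup>2"] differentiable_in_snd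
        B.metric_comp_differentiable' F.metric_comp_differentiable' phi_sq_differentiable\<close>)
  also have "?this \<longleftrightarrow> differentiable_in cd (p, q) (metric_comp G cd e e')"
    by (rule cd.differentiable_in_cong) (use pq in \<open>auto simp: metric_comp_warped\<close>)
  finally show "differentiable_in cd z (metric_comp G cd e e')" using z by simp
qed

text \<open>The inverse of a block diagonal operator is guessed blockwise, with the fibre block
  divided by \<phi>^2, and checked by applying \<open>metric_op\<close> to the guess.\<close>

lemma metric_inv_warped:
  assumes "p \<in> fst c" "q \<in> fst d"
  shows "metric_inv G cd k l (p, q) = metric_inv gB c (fst k) (fst l) p + metric_inv gF d (snd k) (snd l) q / (\<phi> p)\<^sup>2"
proof -
  let ?x = "inv (metric_op gB c p) (fst l)" and ?y = "inv (metric_op gF d q) (snd l) /\<^sub>R (\<phi> p)\<^sup>2"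
  have op: "metric_op G cd (p, q) (?x, ?y) \<bullet> e = l \<bullet> e" for e
  proof -
    have "metric_op G cd (p, q) (?x, ?y) \<bullet> e = metric_comp gB c (fst e) ?x p + (\<phi> p)\<^sup>2 * metric_comp gF d (snd e) ?y q"
      using assms by (simp add: N.metric_op_inner metric_comp_warped)
    also have "\<dots> = metric_op gB c p ?x \<bullet> fst e + (\<phi> p)\<^sup>2 * (metric_op gF d q ?y \<bullet> snd e)"
      using assms by (simp only: B.metric_op_inner F.metric_op_inner)
    also have "\<dots> = l \<bullet> e"
      using assms by (simp add: linear_cmul[OF linear_metric_op] inner_prod_def)
    finally show ?thesis .
  qed
  have "metric_op G cd (p, q) (?x, ?y) = l" by (rule euclidean_eqI) (rule op)
  then have "inv (metric_op G cd (p, q)) l = (?x, ?y)"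
    using assms by (intro N.inv_metric_op_eqI) auto
  then show ?thesis by (simp add: metric_inv_def inner_prod_def divide_inverse mult.commute)
qed

text \<open>The symbols not inherited from a factor come from differentiating \<phi>^2 along the
  base: - grad(\<phi>^2) / 2 times g_F gives - \<phi> grad \<phi> g_F, and \<partial>_i(\<phi>^2) /
  (2 \<phi>^2) gives \<partial>_i \<phi> / \<phi>. On basis vectors \<open>b \<bullet> a\<close> is
  the Kronecker delta left by contracting g_F with its inverse.\<close>

lemma christoffel_warped:
  assumes pq: "p \<in> fst c" "q \<in> fst d"
  shows "christoffel G cd (k, 0) (i, 0) (j, 0) (p, q) = christoffel gB c k i j p"
    "christoffel G cd (k, 0) (i, 0) (0, b) (p, q) = 0"
    "christoffel G cd (k, 0) (0, b) (i, 0) (p, q) = 0"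
    "christoffel G cd (k, 0) (0, a) (0, b) (p, q) = - (\<phi> p * (grad_vec gB c \<phi> p \<bullet> k)) * metric_comp gF d a b q"
    "christoffel G cd (0, a) (i, 0) (j, 0) (p, q) = 0"
    "christoffel G cd (0, a) (i, 0) (0, b) (p, q) = coord_vec c p i \<phi> / \<phi> p * (b \<bullet> a)"
    "christoffel G cd (0, a) (0, b) (i, 0) (p, q) = coord_vec c p i \<phi> / \<phi> p * (b \<bullet> a)"
    "christoffel G cd (0, e) (0, a) (0, b) (p, q) = christoffel gF d e a b q"
proof -
  note [simp] = pq metric_inv_warped[OF pq] coord_vec_metric_comp_warped[OF pq]
  show "christoffel G cd (k, 0) (i, 0) (j, 0) (p, q) = christoffel gB c k i j p"
    "christoffel G cd (k, 0) (i, 0) (0, b) (p, q) = 0"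
    "christoffel G cd (k, 0) (0, b) (i, 0) (p, q) = 0"
    "christoffel G cd (0, a) (i, 0) (j, 0) (p, q) = 0"
    unfolding christoffel_def sum_Basis_prod by simp_all
  show "christoffel G cd (k, 0) (0, a) (0, b) (p, q) = - (\<phi> p * (grad_vec gB c \<phi> p \<bullet> k)) * metric_comp gF d a b q"
    unfolding christoffel_def sum_Basis_prod
    by (simp add: B.grad_vec_inner sum_distrib_left sum_distrib_right sum_negf sum_divide_distrib mult_ac)
  \<comment> \<open>The 2 from the derivative of \<phi>^2 is the one that the halving in
    \<open>christoffel\<close> removes.\<close>
  have "(\<Sum>l\<in>Basis. metric_inv gF d a l q * (2 * \<phi> p * coord_vec c p i \<phi> * metric_comp gF d b l q) / (\<phi> p)\<^sup>2)
      = 2 * coord_vec c p i \<phi> / \<phi> p * (\<Sum>l\<in>Basis. metric_inv gF d a l q * metric_comp gF d l b q)"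
    unfolding sum_distrib_left
    by (intro sum.cong refl) (simp add: F.metric_comp_sym[of q b] power2_eq_square)
  also have "\<dots> = 2 * (coord_vec c p i \<phi> / \<phi> p * (b \<bullet> a))"
    by (simp add: F.metric_inv_metric_comp)
  finally show 1: "christoffel G cd (0, a) (i, 0) (0, b) (p, q) = coord_vec c p i \<phi> / \<phi> p * (b \<bullet> a)"
    unfolding christoffel_def sum_Basis_prod by simp
  then show "christoffel G cd (0, a) (0, b) (i, 0) (p, q) = coord_vec c p i \<phi> / \<phi> p * (b \<bullet> a)"
    using N.christoffel_sym[of "(p, q)" "(0, a)" "(0, b)" "(i, 0)"] by simp
  show "christoffel G cd (0, e) (0, a) (0, b) (p, q) = christoffel gF d e a b q"
    unfolding christoffel_def sum_Basis_prod
    by simp (auto intro!: sum.cong simp: field_simps)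
qed

text \<open>Symbols inherited from one factor are differentiated inside that factor. The new ones go
  through \<open>coord_vec_multI\<close>, whose premises amount to differentiability of
  d\<phi>/\<phi> and of \<phi> grad \<phi>.\<close>

lemma coord_vec_christoffel_warped:
  assumes pq: "p \<in> fst c" "q \<in> fst d"
  shows "coord_vec cd (p, q) e (christoffel G cd (k, 0) (i, 0) (j, 0)) = coord_vec c p (fst e) (christoffel gB c k i j)"
    "coord_vec cd (p, q) e (christoffel G cd (k, 0) (i, 0) (0, b)) = 0"
    "coord_vec cd (p, q) e (christoffel G cd (k, 0) (0, b) (i, 0)) = 0"
    "coord_vec cd (p, q) e (christoffel G cd (k, 0) (0, a) (0, b)) =
      - (coord_vec c p (fst e) \<phi> * (grad_vec gB c \<phi> p \<bullet> k)
        + \<phi> p * coord_vec c p (fst e) (\<lambda>p. grad_vec gB c \<phi> p \<bullet> k)) * metric_comp gF d a b q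
      - \<phi> p * (grad_vec gB c \<phi> p \<bullet> k) * coord_vec d q (snd e) (metric_comp gF d a b)"
    "coord_vec cd (p, q) e (christoffel G cd (0, a) (i, 0) (j, 0)) = 0"
    "coord_vec cd (p, q) e (christoffel G cd (0, a) (i, 0) (0, b)) =
      (coord_vec c p (fst e) (\<lambda>p. coord_vec c p i \<phi>) / \<phi> p
        - coord_vec c p i \<phi> * coord_vec c p (fst e) \<phi> / (\<phi> p)\<^sup>2) * (b \<bullet> a)"
    "coord_vec cd (p, q) e (christoffel G cd (0, a) (0, b) (i, 0)) =
      (coord_vec c p (fst e) (\<lambda>p. coord_vec c p i \<phi>) / \<phi> p
        - coord_vec c p i \<phi> * coord_vec c p (fst e) \<phi> / (\<phi> p)\<^sup>2) * (b \<bullet> a)"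
    "coord_vec cd (p, q) e (christoffel G cd (0, a') (0, a) (0, b)) = coord_vec d q (snd e) (christoffel gF d a' a b)"
proof -
  note S = christoffel_warped
  show "coord_vec cd (p, q) e (christoffel G cd (k, 0) (i, 0) (j, 0)) = coord_vec c p (fst e) (christoffel gB c k i j)"
    by (rule coord_vec_fstI[OF pq]) (rule S)
  show "coord_vec cd (p, q) e (christoffel G cd (k, 0) (i, 0) (0, b)) = 0"
    "coord_vec cd (p, q) e (christoffel G cd (k, 0) (0, b) (i, 0)) = 0"
    "coord_vec cd (p, q) e (christoffel G cd (0, a) (i, 0) (j, 0)) = 0"
    by (rule coord_vec_zeroI[OF pq], rule S, assumption, assumption)+
  show "coord_vec cd (p, q) e (christoffel G cd (0, a') (0, a) (0, b)) = coord_vec d q (snd e) (christoffel gF d a' a b)"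
    by (rule coord_vec_sndI[OF pq]) (rule S)
  have d1: "differentiable_in c p (\<lambda>p. coord_vec c p i \<phi> / \<phi> p)"
    and e1: "coord_vec c p (fst e) (\<lambda>p. coord_vec c p i \<phi> / \<phi> p) =
      coord_vec c p (fst e) (\<lambda>p. coord_vec c p i \<phi>) / \<phi> p - coord_vec c p i \<phi> * coord_vec c p (fst e) \<phi> / (\<phi> p)\<^sup>2"
    using pq phi_differentiable B.smooth_differentiable_in_coord_vec(1)[OF phi_smooth]
    by (auto intro!: B.differentiable_in_divide B.coord_vec_divide)
  show "coord_vec cd (p, q) e (christoffel G cd (0, a) (i, 0) (0, b)) =
      (coord_vec c p (fst e) (\<lambda>p. coord_vec c p i \<phi>) / \<phi> p
        - coord_vec c p i \<phi> * coord_vec c p (fst e) \<phi> / (\<phi> p)\<^sup>2) * (b \<bullet> a)"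
    "coord_vec cd (p, q) e (christoffel G cd (0, a) (0, b) (i, 0)) =
      (coord_vec c p (fst e) (\<lambda>p. coord_vec c p i \<phi>) / \<phi> p
        - coord_vec c p i \<phi> * coord_vec c p (fst e) \<phi> / (\<phi> p)\<^sup>2) * (b \<bullet> a)"
    using coord_vec_multI[where h = "christoffel G cd (0, a) (i, 0) (0, b)", OF pq S(6) d1 differentiable_in_const]
      coord_vec_multI[where h = "christoffel G cd (0, a) (0, b) (i, 0)", OF pq S(7) d1 differentiable_in_const] e1
    by simp_all
  have gd: "differentiable_in c p (\<lambda>p. grad_vec gB c \<phi> p \<bullet> k)"
    by (rule B.grad_vec_differentiable[OF pq(1) phi_smooth])
  have d2: "differentiable_in c p (\<lambda>p. - (\<phi> p * (grad_vec gB c \<phi> p \<bullet> k)))"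
    using differentiable_in_mult[OF differentiable_in_const[of c p "-1"] differentiable_in_mult[OF phi_differentiable[OF pq(1)] gd]] by simp
  have e2: "coord_vec c p (fst e) (\<lambda>p. - (\<phi> p * (grad_vec gB c \<phi> p \<bullet> k))) =
      - (coord_vec c p (fst e) \<phi> * (grad_vec gB c \<phi> p \<bullet> k)
        + \<phi> p * coord_vec c p (fst e) (\<lambda>p. grad_vec gB c \<phi> p \<bullet> k))"
    using coord_vec_cmult[of c p "fst e" "-1" "\<lambda>p. \<phi> p * (grad_vec gB c \<phi> p \<bullet> k)"]
      B.coord_vec_mult[OF pq(1) phi_differentiable[OF pq(1)] gd] by simp
  show "coord_vec cd (p, q) e (christoffel G cd (k, 0) (0, a) (0, b)) =
      - (coord_vec c p (fst e) \<phi> * (grad_vec gB c \<phi> p \<bullet> k)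
        + \<phi> p * coord_vec c p (fst e) (\<lambda>p. grad_vec gB c \<phi> p \<bullet> k)) * metric_comp gF d a b q
      - \<phi> p * (grad_vec gB c \<phi> p \<bullet> k) * coord_vec d q (snd e) (metric_comp gF d a b)"
    using coord_vec_multI[where h = "christoffel G cd (k, 0) (0, a) (0, b)",
        OF pq S(4) d2 F.metric_comp_differentiable'[OF pq(2)]] e2 by simp
qed

section \<open>Curvature of the warped product\<close>

text \<open>These are the diagonal terms of the trace defining Ricci, split by the direction traced
  over. In a fibre direction, the d\<phi> d\<phi> / \<phi>^2 term from the derivative of the
  quotient d\<phi>/\<phi> cancels against the quadratic Christoffel term, so each of the m fibre
  directions contributes - Hess \<phi> / \<phi>.\<close>

lemma riemann_comp_warped_base:
  assumes pq: "p \<in> fst c" "q \<in> fst d"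
  shows "riemann_comp G cd (k, 0) (k, 0) (i, 0) (j, 0) (p, q) = riemann_comp gB c k k i j p"
    and "a \<in> Basis \<Longrightarrow> riemann_comp G cd (0, a) (0, a) (i, 0) (j, 0) (p, q) =
      - (coord_vec c p i (\<lambda>q. coord_vec c q j \<phi>)
        - (\<Sum>k\<in>Basis. christoffel gB c k i j p * coord_vec c p k \<phi>)) / \<phi> p"
proof -
  show "riemann_comp G cd (k, 0) (k, 0) (i, 0) (j, 0) (p, q) = riemann_comp gB c k k i j p"
    unfolding riemann_comp_def sum_Basis_prod
    by (simp add: coord_vec_christoffel_warped[OF pq] christoffel_warped[OF pq])
  assume a: "a \<in> Basis"
  have "riemann_comp G cd (0, a) (0, a) (i, 0) (j, 0) (p, q) =
      - (coord_vec c p i (\<lambda>p. coord_vec c p j \<phi>) / \<phi> p - coord_vec c p j \<phi> * coord_vec c p i \<phi> / (\<phi> p)\<^sup>2)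
      + (\<Sum>r\<in>Basis. coord_vec c p r \<phi> / \<phi> p * christoffel gB c r i j p)
      - (\<Sum>b\<in>Basis. (b \<bullet> a) * (coord_vec c p i \<phi> * coord_vec c p j \<phi> / (\<phi> p)\<^sup>2 * (a \<bullet> b)))"
    unfolding riemann_comp_def sum_Basis_prod using a
    by (simp add: coord_vec_christoffel_warped[OF pq] christoffel_warped[OF pq]
        sum_negf power2_eq_square mult_ac)
  then show "riemann_comp G cd (0, a) (0, a) (i, 0) (j, 0) (p, q) =
      - (coord_vec c p i (\<lambda>q. coord_vec c q j \<phi>)
        - (\<Sum>k\<in>Basis. christoffel gB c k i j p * coord_vec c p k \<phi>)) / \<phi> p"
    unfolding sum_Basis_inner_mult[OF a] using a
    by (simp add: sum_divide_distrib diff_divide_distrib mult_ac)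
qed

text \<open>For a base direction every term vanishes by itself. For a fibre direction two quadratic
  terms survive, each d\<phi>/\<phi> times a Christoffel symbol of the fibre, and they cancel; in
  the last case only after the lower indices of one symbol are exchanged.\<close>

lemma riemann_comp_warped_mixed:
  assumes pq: "p \<in> fst c" "q \<in> fst d" and ab: "a \<in> Basis" "b \<in> Basis"
  shows "riemann_comp G cd (k, 0) (k, 0) (i, 0) (0, b) (p, q) = 0"
    and "riemann_comp G cd (0, a) (0, a) (i, 0) (0, b) (p, q) = 0"
    and "riemann_comp G cd (k, 0) (k, 0) (0, b) (i, 0) (p, q) = 0"
    and "riemann_comp G cd (0, a) (0, a) (0, b) (i, 0) (p, q) = 0"
proof -
  note S = coord_vec_christoffel_warped[OF pq] christoffel_warped[OF pq]
  show "riemann_comp G cd (k, 0) (k, 0) (i, 0) (0, b) (p, q) = 0"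
    "riemann_comp G cd (k, 0) (k, 0) (0, b) (i, 0) (p, q) = 0"
    unfolding riemann_comp_def sum_Basis_prod by (simp_all add: S)
  show "riemann_comp G cd (0, a) (0, a) (i, 0) (0, b) (p, q) = 0"
    unfolding riemann_comp_def sum_Basis_prod
    by (simp add: S sum_subtractf sum_divide_distrib[symmetric] mult_ac
        sum_Basis_inner_mult(1)[OF ab(2)] sum_Basis_inner_mult(2)[OF ab(1)])
  show "riemann_comp G cd (0, a) (0, a) (0, b) (i, 0) (p, q) = 0"
    unfolding riemann_comp_def sum_Basis_prod
    by (simp add: S sum_subtractf sum_divide_distrib[symmetric] mult_ac
        sum_Basis_inner_mult(1)[OF ab(1)] sum_Basis_inner_mult(1)[OF ab(2)] F.christoffel_sym[OF pq(2), of a b a])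
qed

text \<open>In a base direction, the product rule for \<phi> grad \<phi> yields a term \<partial>_k
  \<phi> times the k-th gradient component, which the quadratic part cancels; the rest is one
  summand of the divergence of grad \<phi>. In a fibre direction, the two passages through the base,
  fibre to base to fibre, give the |grad \<phi>|^2 correction to the curvature of the fibre.\<close>

lemma riemann_comp_warped_fibre:
  assumes pq: "p \<in> fst c" "q \<in> fst d" and ab: "a \<in> Basis" "b \<in> Basis" "e \<in> Basis"
  shows "riemann_comp G cd (k, 0) (k, 0) (0, a) (0, b) (p, q) =
      - \<phi> p * (coord_vec c p k (\<lambda>p. grad_vec gB c \<phi> p \<bullet> k)
        + (\<Sum>r\<in>Basis. christoffel gB c k k r p * (grad_vec gB c \<phi> p \<bullet> r))) * metric_comp gF d a b q"
    and "riemann_comp G cd (0, e) (0, e) (0, a) (0, b) (p, q) =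
      riemann_comp gF d e e a b q - (\<Sum>r\<in>Basis. (grad_vec gB c \<phi> p \<bullet> r) * coord_vec c p r \<phi>)
        * (metric_comp gF d a b q - (a \<bullet> e) * metric_comp gF d e b q)"
proof -
  note S = coord_vec_christoffel_warped[OF pq] christoffel_warped[OF pq]
  let ?u = "\<lambda>r. grad_vec gB c \<phi> p \<bullet> r"
  have "riemann_comp G cd (k, 0) (k, 0) (0, a) (0, b) (p, q) =
     - (coord_vec c p k \<phi> * ?u k + \<phi> p * coord_vec c p k (\<lambda>p. grad_vec gB c \<phi> p \<bullet> k)) * metric_comp gF d a b q
     + (\<Sum>r\<in>Basis. christoffel gB c k k r p * (- (\<phi> p * ?u r) * metric_comp gF d a b q))
     + (\<Sum>x\<in>Basis. (b \<bullet> x) * (coord_vec c p k \<phi> * ?u k * metric_comp gF d a x q))"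
    unfolding riemann_comp_def sum_Basis_prod
    by (simp add: S sum_negf pq mult_ac)
  then show "riemann_comp G cd (k, 0) (k, 0) (0, a) (0, b) (p, q) =
      - \<phi> p * (coord_vec c p k (\<lambda>p. grad_vec gB c \<phi> p \<bullet> k)
        + (\<Sum>r\<in>Basis. christoffel gB c k k r p * ?u r)) * metric_comp gF d a b q"
    unfolding sum_Basis_inner_mult[OF ab(2)]
    by (simp add: sum_distrib_left sum_distrib_right sum_negf algebra_simps)
  have "riemann_comp G cd (0, e) (0, e) (0, a) (0, b) (p, q) = riemann_comp gF d e e a b q
      - (\<Sum>r\<in>Basis. ?u r * coord_vec c p r \<phi> * metric_comp gF d a b q)
      + (\<Sum>r\<in>Basis. ?u r * coord_vec c p r \<phi> * ((a \<bullet> e) * metric_comp gF d e b q))"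
    unfolding riemann_comp_def sum_Basis_prod using ab
    by (simp add: S sum_subtractf sum_negf pq mult_ac)
  then show "riemann_comp G cd (0, e) (0, e) (0, a) (0, b) (p, q) =
      riemann_comp gF d e e a b q - (\<Sum>r\<in>Basis. ?u r * coord_vec c p r \<phi>)
        * (metric_comp gF d a b q - (a \<bullet> e) * metric_comp gF d e b q)"
    unfolding sum_distrib_right[symmetric] by (simp add: algebra_simps)
qed

lemma laplacian_eq:
  assumes "p \<in> fst c"
  shows "laplacian B gB c u p = (\<Sum>k\<in>Basis. coord_vec c p k (\<lambda>p. grad_vec gB c u p \<bullet> k)
        + (\<Sum>r\<in>Basis. christoffel gB c k k r p * (grad_vec gB c u p \<bullet> r)))"
proof -
  have "coord_vec c p k (\<lambda>q. vec_comp c (grad B gB u q) k) = coord_vec c p k (\<lambda>p. grad_vec gB c u p \<bullet> k)" for k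
    by (rule B.coord_vec_cong[OF assms]) (simp add: B.grad_eq)
  then show ?thesis using assms by (simp add: laplacian_def divergence_def B.grad_eq)
qed

text \<open>The second form exchanges the roles of the two functions: it equates differentiating
  \<open>u\<close> along grad \<open>v\<close> with differentiating \<open>v\<close> along grad
  \<open>u\<close>. In the Hessian the sum arises with the gradient of \<phi>, while
  \<open>k\<close> is written with the gradient of \<open>f\<close>.\<close>

lemma metric_grad_grad:
  assumes "p \<in> fst c"
  shows "gB p (grad B gB u p) (grad B gB v p) = (\<Sum>r\<in>Basis. (grad_vec gB c v p \<bullet> r) * coord_vec c p r u)"
    and "grad B gB v p u = (\<Sum>r\<in>Basis. (grad_vec gB c u p \<bullet> r) * coord_vec c p r v)"
proof -
  have 1: "gB p (grad B gB u p) (grad B gB v p) = grad B gB v p u" for u v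
    using B.metric_comp_grad_vec[OF assms, of u "grad_vec gB c v p"] assms
    by (simp add: B.grad_eq metric_comp_def)
  show "gB p (grad B gB u p) (grad B gB v p) = (\<Sum>r\<in>Basis. (grad_vec gB c v p \<bullet> r) * coord_vec c p r u)"
    unfolding 1 by (rule B.grad_apply[OF assms])
  have "grad B gB v p u = grad B gB u p v"
    using 1[of u v] 1[of v u] B.metric_comp_sym[OF assms, of "grad_vec gB c v p" "grad_vec gB c u p"] assms
    by (simp add: B.grad_eq metric_comp_def)
  then show "grad B gB v p u = (\<Sum>r\<in>Basis. (grad_vec gB c u p \<bullet> r) * coord_vec c p r v)"
    using B.grad_apply[OF assms] by simp
qed

lemma ricci_warped:
  assumes pq: "p \<in> fst c" "q \<in> fst d"
  shows "ricci G cd (p, q) (coord_vec cd (p, q) e) (coord_vec cd (p, q) e') =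
    ricci gB c p (coord_vec c p (fst e)) (coord_vec c p (fst e'))
    - real DIM('d) / \<phi> p * hess gB c \<phi> p (coord_vec c p (fst e)) (coord_vec c p (fst e'))
    + ricci gF d q (coord_vec d q (snd e)) (coord_vec d q (snd e'))
    - (\<phi> p * laplacian B gB c \<phi> p + (real DIM('d) - 1) * gB p (grad B gB \<phi> p) (grad B gB \<phi> p))
      * metric_comp gF d (snd e) (snd e') q"
proof -
  let ?R = "\<lambda>i j. \<Sum>k\<in>Basis. riemann_comp G cd k k i j (p, q)"
  let ?H = "\<lambda>i j. coord_vec c p i (\<lambda>q. coord_vec c q j \<phi>) - (\<Sum>k\<in>Basis. christoffel gB c k i j p * coord_vec c p k \<phi>)"
  let ?L = "laplacian B gB c \<phi> p" and ?N = "gB p (grad B gB \<phi> p) (grad B gB \<phi> p)"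
  let ?m = "real DIM('d)"
  have BB: "?R (i, 0) (j, 0) = (\<Sum>k\<in>Basis. riemann_comp gB c k k i j p) - ?m / \<phi> p * ?H i j" for i j
    unfolding sum_Basis_prod by (simp add: riemann_comp_warped_base[OF pq] diff_divide_distrib algebra_simps)
  have mixed: "?R (i, 0) (0, b) = 0" "?R (0, b) (i, 0) = 0" if "b \<in> Basis" for i b
    unfolding sum_Basis_prod using that by (simp_all add: riemann_comp_warped_mixed[OF pq])
  have FF: "?R (0, a) (0, b) = (\<Sum>k\<in>Basis. riemann_comp gF d k k a b q)
      - (\<phi> p * ?L + (?m - 1) * ?N) * metric_comp gF d a b q" if ab: "a \<in> Basis" "b \<in> Basis" for a b
  proof -
    have "(\<Sum>k\<in>Basis. riemann_comp G cd (k, 0) (k, 0) (0, a) (0, b) (p, q)) = - \<phi> p * ?L * metric_comp gF d a b q"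
      unfolding laplacian_eq[OF pq(1)] using ab
      by (simp add: riemann_comp_warped_fibre[OF pq, of a b a] sum_distrib_left sum_distrib_right sum_negf)
    moreover have "(\<Sum>k\<in>Basis. riemann_comp G cd (0, k) (0, k) (0, a) (0, b) (p, q)) =
        (\<Sum>k\<in>Basis. riemann_comp gF d k k a b q - ?N * (metric_comp gF d a b q - (a \<bullet> k) * metric_comp gF d k b q))"
      unfolding metric_grad_grad(1)[OF pq(1)] using ab
      by (intro sum.cong refl riemann_comp_warped_fibre(2)[OF pq])
    \<comment> \<open>The Kronecker term restores exactly one of the m copies of g_F(a, b); this is
      the origin of m - 1.\<close>
    moreover have "\<dots> = (\<Sum>k\<in>Basis. riemann_comp gF d k k a b q) - ?N * (?m * metric_comp gF d a b q - metric_comp gF d a b q)"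
      by (simp add: sum_subtractf sum_distrib_left[symmetric] sum_Basis_inner_mult[OF ab(1)])
    ultimately show ?thesis
      unfolding sum_Basis_prod by (simp add: algebra_simps)
  qed
  have "ricci G cd (p, q) (coord_vec cd (p, q) e) (coord_vec cd (p, q) e') =
     (\<Sum>i\<in>Basis. \<Sum>j\<in>Basis. ?R (i, 0) (j, 0) * (fst e \<bullet> i) * (fst e' \<bullet> j))
     + (\<Sum>a\<in>Basis. \<Sum>b\<in>Basis. ?R (0, a) (0, b) * (snd e \<bullet> a) * (snd e' \<bullet> b))"
    unfolding ricci_def
    by (subst sum_sum_Basis_prod) (use pq in \<open>simp_all add: inner_prod_def mixed\<close>)
  also have "(\<Sum>i\<in>Basis. \<Sum>j\<in>Basis. ?R (i, 0) (j, 0) * (fst e \<bullet> i) * (fst e' \<bullet> j)) =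
      ricci gB c p (coord_vec c p (fst e)) (coord_vec c p (fst e'))
      - ?m / \<phi> p * hess gB c \<phi> p (coord_vec c p (fst e)) (coord_vec c p (fst e'))"
    unfolding BB ricci_def hess_def sum_distrib_left[of "?m / \<phi> p"] sum_subtractf[symmetric] using pq
    by (intro sum.cong refl) (simp add: algebra_simps)
  also have "(\<Sum>a\<in>Basis. \<Sum>b\<in>Basis. ?R (0, a) (0, b) * (snd e \<bullet> a) * (snd e' \<bullet> b)) =
      ricci gF d q (coord_vec d q (snd e)) (coord_vec d q (snd e'))
      - (\<phi> p * ?L + (?m - 1) * ?N) * (\<Sum>a\<in>Basis. \<Sum>b\<in>Basis. metric_comp gF d a b q * (snd e \<bullet> a) * (snd e' \<bullet> b))"
    unfolding ricci_def sum_distrib_left[of "\<phi> p * ?L + (?m - 1) * ?N"] sum_subtractf[symmetric] using pq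
    by (intro sum.cong refl) (simp add: FF algebra_simps)
  also have "(\<Sum>a\<in>Basis. \<Sum>b\<in>Basis. metric_comp gF d a b q * (snd e \<bullet> a) * (snd e' \<bullet> b)) = metric_comp gF d (snd e) (snd e') q"
    by (rule F.metric_comp_expansion2[OF pq(2), symmetric])
  finally show ?thesis by simp
qed

text \<open>Second derivatives of \<open>u \<circ> fst\<close> along the fibre vanish, so the fibre
  block comes entirely from the symbols - \<phi> grad \<phi> g_F; the minus sign in the Hessian
  makes it positive.\<close>

lemma hess_warped:
  assumes pq: "p \<in> fst c" "q \<in> fst d"
  shows "hess G cd (u \<circ> fst) (p, q) (coord_vec cd (p, q) e) (coord_vec cd (p, q) e') =
    hess gB c u p (coord_vec c p (fst e)) (coord_vec c p (fst e'))
    + \<phi> p * grad B gB u p \<phi> * metric_comp gF d (snd e) (snd e') q"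
proof -
  let ?R = "\<lambda>i j. coord_vec cd (p, q) i (\<lambda>z. coord_vec cd z j (u \<circ> fst))
         - (\<Sum>k\<in>Basis. christoffel G cd k i j (p, q) * coord_vec cd (p, q) k (u \<circ> fst))"
  have D: "coord_vec cd (p', q') i (u \<circ> fst) = coord_vec c p' (fst i) u" if "p' \<in> fst c" "q' \<in> fst d" for p' q' i
    by (rule coord_vec_fstI[OF that]) simp
  have DD: "coord_vec cd (p, q) i (\<lambda>z. coord_vec cd z j (u \<circ> fst)) = coord_vec c p (fst i) (\<lambda>p. coord_vec c p (fst j) u)" for i j
    by (rule coord_vec_fstI[OF pq]) (rule D)
  have BB: "?R (i, 0) (j, 0) = coord_vec c p i (\<lambda>q. coord_vec c q j u)
         - (\<Sum>k\<in>Basis. christoffel gB c k i j p * coord_vec c p k u)" for i j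
    unfolding sum_Basis_prod using pq by (simp add: D DD christoffel_warped)
  have mixed: "?R (i, 0) (0, b) = 0" "?R (0, b) (i, 0) = 0" for i b
    unfolding sum_Basis_prod using pq by (simp_all add: D DD christoffel_warped)
  have FF: "?R (0, a) (0, b) = \<phi> p * grad B gB u p \<phi> * metric_comp gF d a b q" for a b
    unfolding sum_Basis_prod metric_grad_grad(2)[OF pq(1)] using pq
    by (simp add: D DD christoffel_warped sum_negf sum_distrib_left sum_distrib_right mult_ac)
  have "hess G cd (u \<circ> fst) (p, q) (coord_vec cd (p, q) e) (coord_vec cd (p, q) e') =
     (\<Sum>i\<in>Basis. \<Sum>j\<in>Basis. ?R (i, 0) (j, 0) * (fst e \<bullet> i) * (fst e' \<bullet> j))
     + (\<Sum>a\<in>Basis. \<Sum>b\<in>Basis. ?R (0, a) (0, b) * (snd e \<bullet> a) * (snd e' \<bullet> b))"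
    unfolding hess_def
    by (subst sum_sum_Basis_prod) (use pq in \<open>simp_all add: inner_prod_def mixed\<close>)
  also have "(\<Sum>i\<in>Basis. \<Sum>j\<in>Basis. ?R (i, 0) (j, 0) * (fst e \<bullet> i) * (fst e' \<bullet> j)) =
      hess gB c u p (coord_vec c p (fst e)) (coord_vec c p (fst e'))"
    unfolding BB hess_def using pq by simp
  also have "(\<Sum>a\<in>Basis. \<Sum>b\<in>Basis. ?R (0, a) (0, b) * (snd e \<bullet> a) * (snd e' \<bullet> b)) =
      \<phi> p * grad B gB u p \<phi> * (\<Sum>a\<in>Basis. \<Sum>b\<in>Basis. metric_comp gF d a b q * (snd e \<bullet> a) * (snd e' \<bullet> b))"
    unfolding FF by (simp add: sum_distrib_left mult_ac)
  also have "(\<Sum>a\<in>Basis. \<Sum>b\<in>Basis. metric_comp gF d a b q * (snd e \<bullet> a) * (snd e' \<bullet> b)) = metric_comp gF d (snd e) (snd e') q"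
    by (rule F.metric_comp_expansion2[OF pq(2), symmetric])
  finally show ?thesis .
qed

text \<open>The dual form of \<xi> is the differential of \<open>f \<circ> fst\<close>, which
  vanishes on vertical vectors, so \<open>mu\<close> enters the base part alone. The term -
  \<lambda> \<phi>^2 of \<open>k\<close> comes from the factor \<phi>^2 in the fibre block of the
  metric.\<close>

lemma soliton_tensor_warped:
  assumes pq: "p \<in> fst c" "q \<in> fst d" and f: "smooth_on (snd c ` fst c) (f \<circ> chart_inv c)"
    and \<xi>: "\<xi> = grad N G (f \<circ> fst)"
  shows "lie_deriv G cd \<xi> (p, q) (coord_vec cd (p, q) e) (coord_vec cd (p, q) e')
      + 2 * ricci G cd (p, q) (coord_vec cd (p, q) e) (coord_vec cd (p, q) e')
      + 2 * lam * G (p, q) (coord_vec cd (p, q) e) (coord_vec cd (p, q) e')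
      + 2 * mu * (dual_form G \<xi> (p, q) (coord_vec cd (p, q) e) * dual_form G \<xi> (p, q) (coord_vec cd (p, q) e')) =
    2 * (ricci gB c p (coord_vec c p (fst e)) (coord_vec c p (fst e'))
      + hess gB c f p (coord_vec c p (fst e)) (coord_vec c p (fst e'))
      - real DIM('d) / \<phi> p * hess gB c \<phi> p (coord_vec c p (fst e)) (coord_vec c p (fst e'))
      + lam * gB p (coord_vec c p (fst e)) (coord_vec c p (fst e'))
      + mu * (differential f p (coord_vec c p (fst e)) * differential f p (coord_vec c p (fst e'))))
    + 2 * (ricci gF d q (coord_vec d q (snd e)) (coord_vec d q (snd e'))
      - (- lam * (\<phi> p)\<^sup>2 + \<phi> p * laplacian B gB c \<phi> p
          + (real DIM('d) - 1) * gB p (grad B gB \<phi> p) (grad B gB \<phi> p) - \<phi> p * grad B gB f p \<phi>)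
        * gF q (coord_vec d q (snd e)) (coord_vec d q (snd e')))"
proof -
  have z: "(p, q) \<in> fst cd" using pq by simp
  have "dual_form G \<xi> (p, q) (coord_vec cd (p, q) e) = differential f p (coord_vec c p (fst e))" for e
    using N.metric_comp_grad_vec[OF z, of "f \<circ> fst" e] coord_vec_fst[OF pq, of e f]
    by (simp add: \<xi> dual_form_def N.grad_eq[OF z] metric_comp_def differential_def o_def)
  moreover have "lie_deriv G cd \<xi> (p, q) v w = 2 * hess G cd (f \<circ> fst) (p, q) v w" for v w
    unfolding \<xi> by (rule N.lie_deriv_grad[OF z smooth_on_compose_fst[OF f]])
  moreover have "G (p, q) (coord_vec cd (p, q) e) (coord_vec cd (p, q) e') =
      gB p (coord_vec c p (fst e)) (coord_vec c p (fst e'))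
      + (\<phi> p)\<^sup>2 * gF q (coord_vec d q (snd e)) (coord_vec d q (snd e'))"
    using metric_comp_warped[OF pq, of e e'] by (simp add: metric_comp_def)
  ultimately show ?thesis
    by (simp add: ricci_warped[OF pq] hess_warped[OF pq] metric_comp_def algebra_simps)
qed

end

section \<open>From product charts to the product manifold\<close>

lemma atlas_prod_manifold:
  "atlas (prod_manifold M N) = {prod_chart c d | c d. c \<in> atlas M \<and> d \<in> atlas N}"
  by (simp add: prod_manifold_def prod_chart_def)

lemma tangent_space_prod_manifold:
  assumes M: "smooth_manifold M" and N: "smooth_manifold N"
    and c: "c \<in> atlas M" "p \<in> fst c" and d: "d \<in> atlas N" "q \<in> fst d"
  shows "tangent_space (prod_manifold M N) (p, q) = range (coord_vec (prod_chart c d) (p, q))"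
proof (rule tangent_space_eq_range)
  have cp: "chart_pair c d" if "c \<in> atlas M" "d \<in> atlas N" for c d
    using smooth_manifold_regular_chart[OF M that(1)] smooth_manifold_regular_chart[OF N that(2)]
    by (rule chart_pair.intro)
  show "regular_chart x" if "x \<in> atlas (prod_manifold M N)" for x
  proof -
    obtain c d where x: "x = prod_chart c d" and cd: "c \<in> atlas M" "d \<in> atlas N"
      using \<open>x \<in> _\<close> by (auto simp: atlas_prod_manifold)
    interpret chart_pair c d by (rule cp[OF cd])
    show ?thesis unfolding x by (rule cd.regular_chart_axioms)
  qed
  show "compatible_charts x y" if "x \<in> atlas (prod_manifold M N)" "y \<in> atlas (prod_manifold M N)" for x y
    using that smooth_manifold_compatible_charts[OF M] smooth_manifold_compatible_charts[OF N]
    by (auto simp: atlas_prod_manifold intro!: chart_pair.compatible_prod_chart[OF cp])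
  show "prod_chart c d \<in> atlas (prod_manifold M N)"
    using c d unfolding atlas_prod_manifold by blast
  show "(p, q) \<in> fst (prod_chart c d)" using c d by simp
qed

text \<open>\<open>k\<close> has a chart argument because \<open>laplacian\<close> is computed in a
  chart. Letting the base chart and base point range freely in the fibre equation expresses that it
  holds on every fibre.\<close>

theorem theorem4p3:
  fixes B :: "('a, 'b::euclidean_space) manifold" and gB :: "'a tensor2"
    and F :: "('c, 'd::euclidean_space) manifold" and gF :: "'c tensor2"
    and \<phi> f :: "'a \<Rightarrow> real" and m lam mu :: real
    and N :: "('a \<times> 'c, 'b \<times> 'd) manifold" and g :: "('a \<times> 'c) tensor2"
    and \<xi> :: "('a \<times> 'c) vfield" and k :: "('a, 'b) chart \<Rightarrow> 'a \<Rightarrow> real"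
  assumes "riemannian_manifold B gB"
    and "smooth_fun B \<phi>" and "\<forall>p\<in>points B. \<phi> p > 0" and "smooth_fun B f"
    and "m > 1"
    and "\<forall>c\<in>atlas B. \<forall>p\<in>fst c. \<forall>v\<in>tangent_space B p. \<forall>w\<in>tangent_space B p.
           ricci gB c p v w + hess gB c f p v w - m / \<phi> p * hess gB c \<phi> p v w
           + lam * gB p v w + mu * (differential f p v * differential f p w) = 0"
    and "riemannian_manifold F gF" and "m = real DIM('d)"
    and N: "N = prod_manifold B F"
    and g: "g = warped_metric \<phi> gB gF"
    and \<xi>: "\<xi> = grad N g (f \<circ> fst)"
    and k: "k = (\<lambda>c p. - lam * (\<phi> p)\<^sup>2 + \<phi> p * laplacian B gB c \<phi> p
                  + (m - 1) * gB p (grad B gB \<phi> p) (grad B gB \<phi> p)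
                  - \<phi> p * grad B gB f p \<phi>)"
  shows "gradient_eta_ricci_soliton N g \<xi> lam mu \<longleftrightarrow>
     (\<forall>c\<in>atlas B. \<forall>p\<in>fst c. \<forall>v\<in>tangent_space B p. \<forall>w\<in>tangent_space B p.
        ricci gB c p v w =
          - hess gB c f p v w + m / \<phi> p * hess gB c \<phi> p v w
          - lam * gB p v w - mu * (differential f p v * differential f p w)) \<and>
     (\<forall>c\<in>atlas B. \<forall>p\<in>fst c.
        \<forall>d\<in>atlas F. \<forall>q\<in>fst d. \<forall>v\<in>tangent_space F q. \<forall>w\<in>tangent_space F q.
          ricci gF d q v w = k c p * gF q v w)"
proof -
  have MB: "smooth_manifold B" and MF: "smooth_manifold F"
    using assms(1,7) by (simp_all add: riemannian_manifold_def)
  have W: "warped_charts c B gB d F gF \<phi> N" if "c \<in> atlas B" "d \<in> atlas F" for c d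
  proof -
    interpret B: metric_chart c B gB using riemannian_metric_chart[OF assms(1) that(1)] .
    interpret F: metric_chart d F gF using riemannian_metric_chart[OF assms(7) that(2)] .
    show ?thesis
    proof
      show "smooth_on (snd c ` fst c) (\<phi> \<circ> chart_inv c)"
        using assms(2) that by (simp add: smooth_fun_def)
      show "\<phi> p > 0" if "p \<in> fst c" for p
        using assms(3) that smooth_manifold_chart_subset[OF MB \<open>c \<in> _\<close>] by blast
      show "tangent_space N (p, q) = range (coord_vec (prod_chart c d) (p, q))"
        if "p \<in> fst c" "q \<in> fst d" for p q
        unfolding N by (rule tangent_space_prod_manifold) (use MB MF that \<open>c \<in> _\<close> \<open>d \<in> _\<close> in auto)
    qed
  qed
  \<comment> \<open>The witness for the potential in the definition of a gradient soliton; what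
    remains of that definition is the tensor equation.\<close>
  have potential: "smooth_fun N (f \<circ> fst)"
    unfolding smooth_fun_def
  proof
    fix x assume "x \<in> atlas N"
    then obtain c d where x: "x = prod_chart c d" and cd: "c \<in> atlas B" "d \<in> atlas F"
      by (auto simp: N atlas_prod_manifold)
    interpret warped_charts c B gB d F gF \<phi> N by (rule W[OF cd])
    show "smooth_on (snd x ` fst x) (f \<circ> fst \<circ> chart_inv x)"
      unfolding x by (rule smooth_on_compose_fst) (use assms(4) cd in \<open>simp add: smooth_fun_def\<close>)
  qed
  let ?E = "\<lambda>x z v w. lie_deriv g x \<xi> z v w + 2 * ricci g x z v w + 2 * lam * g z v w
        + 2 * mu * (dual_form g \<xi> z v * dual_form g \<xi> z w)"
  have E: "?E (prod_chart c d) (p, q) (coord_vec (prod_chart c d) (p, q) e) (coord_vec (prod_chart c d) (p, q) e') =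
      2 * (ricci gF d q (coord_vec d q (snd e)) (coord_vec d q (snd e'))
        - k c p * gF q (coord_vec d q (snd e)) (coord_vec d q (snd e')))"
    if cd: "c \<in> atlas B" "d \<in> atlas F" and pq: "p \<in> fst c" "q \<in> fst d" for c d p q e e'
  proof -
    interpret warped_charts c B gB d F gF \<phi> N by (rule W[OF cd])
    have "smooth_on (snd c ` fst c) (f \<circ> chart_inv c)"
      using assms(4) cd by (simp add: smooth_fun_def)
    moreover have "ricci gB c p v w + hess gB c f p v w - m / \<phi> p * hess gB c \<phi> p v w
           + lam * gB p v w + mu * (differential f p v * differential f p w) = 0"
      if "v \<in> range (coord_vec c p)" "w \<in> range (coord_vec c p)" for v w
      using assms(6) cd(1) pq(1) that by (simp add: B.tangent)
    ultimately show ?thesis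
      using soliton_tensor_warped[OF pq, of f \<xi> e e' lam mu] \<open>m = real DIM('d)\<close>
      by (simp add: g \<xi> k)
  qed
  have "gradient_eta_ricci_soliton N g \<xi> lam mu \<longleftrightarrow>
      (\<forall>x\<in>atlas N. \<forall>z\<in>fst x. \<forall>v\<in>tangent_space N z. \<forall>w\<in>tangent_space N z. ?E x z v w = 0)"
    unfolding gradient_eta_ricci_soliton_def using potential \<xi> by blast
  also have "\<dots> \<longleftrightarrow> (\<forall>c\<in>atlas B. \<forall>p\<in>fst c.
        \<forall>d\<in>atlas F. \<forall>q\<in>fst d. \<forall>v\<in>tangent_space F q. \<forall>w\<in>tangent_space F q.
          ricci gF d q v w = k c p * gF q v w)" (is "?sol \<longleftrightarrow> ?fib")
  proof
    assume sol: ?sol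
    show ?fib
    proof (intro ballI)
      fix c p d q v w
      assume cd: "c \<in> atlas B" "d \<in> atlas F" and pq: "p \<in> fst c" "q \<in> fst d"
        and vw: "v \<in> tangent_space F q" "w \<in> tangent_space F q"
      interpret warped_charts c B gB d F gF \<phi> N by (rule W[OF cd])
      obtain e e' where e: "v = coord_vec d q e" "w = coord_vec d q e'"
        using vw pq by (auto simp: F.tangent)
      \<comment> \<open>Vertical vectors, with coordinates \<open>(0, e)\<close>, reach every
        tangent vector of the fibre, so they suffice to extract the fibre equation.\<close>
      have "?E cd (p, q) (coord_vec cd (p, q) (0, e)) (coord_vec cd (p, q) (0, e')) = 0"
      proof -
        have "cd \<in> atlas N" using cd unfolding N atlas_prod_manifold by blast
        then show ?thesis using sol pq by (simp add: tangent_N)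
      qed
      then show "ricci gF d q v w = k c p * gF q v w"
        unfolding E[OF cd pq] by (simp add: e)
    qed
  next
    assume fib: ?fib
    show ?sol
    proof (intro ballI)
      fix x z v w
      assume x: "x \<in> atlas N" and z: "z \<in> fst x" and vw: "v \<in> tangent_space N z" "w \<in> tangent_space N z"
      obtain c d where x: "x = prod_chart c d" and cd: "c \<in> atlas B" "d \<in> atlas F"
        using x by (auto simp: N atlas_prod_manifold)
      interpret warped_charts c B gB d F gF \<phi> N by (rule W[OF cd])
      obtain p q where pq: "z = (p, q)" "p \<in> fst c" "q \<in> fst d"
        using z x by auto
      obtain e e' where e: "v = coord_vec cd z e" "w = coord_vec cd z e'"
        using vw pq by (auto simp: tangent_N)
      show "?E x z v w = 0"
        unfolding x e pq(1) E[OF cd pq(2,3)] using fib cd pq by (simp add: F.tangent)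
    qed
  qed
  \<comment> \<open>The first conjunct on the right is the standing equation on the base solved for
    its Ricci tensor, so the equivalence reduces to the one between soliton and fibre
    equations.\<close>
  moreover have "\<forall>c\<in>atlas B. \<forall>p\<in>fst c. \<forall>v\<in>tangent_space B p. \<forall>w\<in>tangent_space B p.
        ricci gB c p v w =
          - hess gB c f p v w + m / \<phi> p * hess gB c \<phi> p v w
          - lam * gB p v w - mu * (differential f p v * differential f p w)"
  proof (intro ballI)
    fix c p v w
    assume "c \<in> atlas B" "p \<in> fst c" "v \<in> tangent_space B p" "w \<in> tangent_space B p"
    then have "ricci gB c p v w + hess gB c f p v w - m / \<phi> p * hess gB c \<phi> p v w
           + lam * gB p v w + mu * (differential f p v * differential f p w) = 0"
      using assms(6) by blast
    then show "ricci gB c p v w =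
          - hess gB c f p v w + m / \<phi> p * hess gB c \<phi> p v w
          - lam * gB p v w - mu * (differential f p v * differential f p w)"
      by linarith
  qed
  ultimately show ?thesis by blast
qed

end
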